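(* Assume that the random walk is either recurrent or transient to the right, that is $\mathbb E^\nu[\log\rho_0]\le0$, and let $\alpha,\beta\in\mathbb Z_+$. For any integer $n\ge1$ and any real $z>0$, \[ \mathbb P^\nu\left(\big|\widehat m^{\alpha,\beta}-m^{\alpha,\beta}\big|\ge\frac{n}{N_n^\alpha}\binom{\alpha+\beta}{\alpha}^{-1}\sqrt{\frac{z}{2n}}\right)\le2e^{-z}. \]
   Context: Random walk in random environment: $\omega=(\omega_x)_{x\in\mathbb Z}$ i.i.d. with values in $(0,1)$ and law $\nu$; given $\omega$, $(S_t)_{t\ge0}$ is the Markov chain on $\mathbb Z$ with $S_0=0$, stepping from $x$ to $x+1$ with probability $\omega_x$ and to $x-1$ with probability $1-\omega_x$. $\mathbb P^\nu$ is the annealed law (quenched law integrated against $\nu^{\otimes\mathbb Z}$), $\mathbb E^\nu$ its expectation; $\rho_x=(1-\omega_x)/\omega_x$. $T_n=\inf\{t\ge0:S_t=n\}$. $L(t_0,x)=\sum_{0\le t\le t_0-1}\mathbf 1_{\{S_t=x,\,S_{t+1}=x-1\}}$ and $Z^n_x=L(T_n,n-x)$, $0\le x\le n$. $m^{\alpha,\beta}=\int_0^1a^\alpha(1-a)^\beta\nu(\mathrm da)$. $\Phi_{\alpha,\beta}(i,j)=\mathbf 1_{\{i\ge\alpha,j\ge\beta\}}\binom{i+j-(\alpha+\beta)}{i-\alpha}/\binom{i+j}{i}$. $N_n^\alpha=\sum_{x=0}^{n-1}\mathbf 1_{\{Z^n_x\ge\alpha\}}$ and $\widehat m^{\alpha,\beta}=\frac1{N_n^\alpha}\sum_{x=1}^n\Phi_{\alpha,\beta}(Z^n_{x-1},Z^n_x)$,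 with the convention $0/0=0$ (and the threshold in the probability is $+\infty$ when $N_n^\alpha=0$). *)

theory Defs
  imports "HOL-Probability.Probability"
begin

text \<open>Environment: omega :: int => real. Driving randomness: i.i.d. uniform U_t on [0,1].
  Given omega, the walk steps from x to x+1 iff U_t < omega x, i.e. with probability omega x,
  independently over t: this realises the quenched Markov chain.\<close>

primrec walk :: "(int \<Rightarrow> real) \<Rightarrow> (nat \<Rightarrow> real) \<Rightarrow> nat \<Rightarrow> int" where
  "walk \<omega> U 0 = 0"
| "walk \<omega> U (Suc t) = walk \<omega> U t + (if U t < \<omega> (walk \<omega> U t) then 1 else -1)"

definition hit :: "(int \<Rightarrow> real) \<Rightarrow> (nat \<Rightarrow> real) \<Rightarrow> nat \<Rightarrow> nat" where
  "hit \<omega> U n = (LEAST t. walk \<omega> U t = int n)"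

definition loc :: "(int \<Rightarrow> real) \<Rightarrow> (nat \<Rightarrow> real) \<Rightarrow> nat \<Rightarrow> int \<Rightarrow> nat" where
  "loc \<omega> U t0 x = card {t. t < t0 \<and> walk \<omega> U t = x \<and> walk \<omega> U (Suc t) = x - 1}"

definition Zn :: "(int \<Rightarrow> real) \<Rightarrow> (nat \<Rightarrow> real) \<Rightarrow> nat \<Rightarrow> nat \<Rightarrow> nat" where
  "Zn \<omega> U n x = loc \<omega> U (hit \<omega> U n) (int n - int x)"

definition Nn :: "nat \<Rightarrow> (int \<Rightarrow> real) \<Rightarrow> (nat \<Rightarrow> real) \<Rightarrow> nat \<Rightarrow> nat" where
  "Nn \<alpha> \<omega> U n = card {x. x < n \<and> Zn \<omega> U n x \<ge> \<alpha>}"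

definition Phi :: "nat \<Rightarrow> nat \<Rightarrow> nat \<Rightarrow> nat \<Rightarrow> real" where
  "Phi \<alpha> \<beta> i j = (if i \<ge> \<alpha> \<and> j \<ge> \<beta>
      then real ((i + j - (\<alpha> + \<beta>)) choose (i - \<alpha>)) / real ((i + j) choose i) else 0)"

text \<open>Division by zero is 0 in Isabelle, matching the convention 0/0 = 0.\<close>
definition mhat :: "nat \<Rightarrow> nat \<Rightarrow> (int \<Rightarrow> real) \<Rightarrow> (nat \<Rightarrow> real) \<Rightarrow> nat \<Rightarrow> real" where
  "mhat \<alpha> \<beta> \<omega> U n =
     (\<Sum>x = 1..n. Phi \<alpha> \<beta> (Zn \<omega> U n (x - 1)) (Zn \<omega> U n x)) / real (Nn \<alpha> \<omega> U n)"

definition mom :: "real measure \<Rightarrow> nat \<Rightarrow> nat \<Rightarrow> real" where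
  "mom \<nu> \<alpha> \<beta> = (\<integral>a. a ^ \<alpha> * (1 - a) ^ \<beta> \<partial>\<nu>)"

definition rho :: "real \<Rightarrow> real" where
  "rho a = (1 - a) / a"

definition annealed :: "real measure \<Rightarrow> ((int \<Rightarrow> real) \<times> (nat \<Rightarrow> real)) measure" where
  "annealed \<nu> = (PiM UNIV (\<lambda>_::int. \<nu>)) \<Otimes>\<^sub>M (PiM UNIV (\<lambda>_::nat. uniform_measure lborel {0..1::real}))"

end

theory Submission
  imports Defs
begin

text \<open>
  Given the environment, \<open>Z\<^sup>n\<close> is a branching chain read from site \<open>n\<close> down to site \<open>0\<close>: conditionally
  on \<open>Z\<^sub>x\<^sub>-\<^sub>1 = i\<close>, \<open>Z\<^sub>x\<close> is the number of failures before the \<open>(i+1)\<close>-th success of probability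
  \<open>\<omega>\<^sub>n\<^sub>-\<^sub>x\<close>, and a fresh environment variable is used at each step. Summing the negative binomial series
  shows that \<open>\<Phi>(Z\<^sub>x\<^sub>-\<^sub>1, Z\<^sub>x)\<close> has conditional annealed mean \<open>m\<close> on \<open>Z\<^sub>x\<^sub>-\<^sub>1 \<ge> \<alpha>\<close> and vanishes otherwise;
  its range is an interval of length \<open>1 / ((\<alpha>+\<beta>) choose \<alpha>)\<close>, so Hoeffding's lemma and Chernoff's bound apply
  to the martingale \<open>N (mhat - m)\<close>.

  Only an upper bound for exponential moments on \<open>{T\<^sub>n < \<infinity>}\<close> is needed. It follows from a function of
  the left-step counts and the position that is harmonic for the walk and equals the reward at
  time \<open>T\<^sub>n\<close>, which replaces the strong Markov property.

  For \<open>T\<^sub>n < \<infinity>\<close>, the escape probability \<open>v\<close> is harmonic left of \<open>n\<close>, and its boundedness gives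
  \<open>v(n-1) W \<le> 1\<close> with \<open>W = \<Sum>\<^sub>k \<Prod>\<^sub>j\<^sub><\<^sub>k 1/\<rho>\<^sub>n\<^sub>-\<^sub>1\<^sub>-\<^sub>j\<close>. The fixed-point equation \<open>W = 1 + W'/\<rho>\<close> in law
  and the drift hypothesis force \<open>W = \<infinity>\<close>.
\<close>

section \<open>The reward at the hitting time\<close>

lemma nn_integral_PiM_case_nat:
  assumes "prob_space M" and [measurable]: "f \<in> borel_measurable (PiM UNIV (\<lambda>_::nat. M))"
  shows "(\<integral>\<^sup>+X. f X \<partial>PiM UNIV (\<lambda>_::nat. M)) =
    (\<integral>\<^sup>+x. \<integral>\<^sup>+X. f (case_nat x X) \<partial>PiM UNIV (\<lambda>_::nat. M) \<partial>M)"
proof -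
  interpret prob_space M by fact
  interpret S: sequence_space M ..
  interpret P: pair_sigma_finite M "PiM UNIV (\<lambda>_::nat. M)" ..
  have "(\<integral>\<^sup>+X. f X \<partial>S.S) = (\<integral>\<^sup>+X. f ((\<lambda>(s, w). case_nat s w) X) \<partial>(M \<Otimes>\<^sub>M S.S))"
    by (subst S.PiM_iter[symmetric]) (simp add: nn_integral_distr)
  also have "\<dots> = (\<integral>\<^sup>+x. \<integral>\<^sup>+X. f ((\<lambda>(s, w). case_nat s w) (x, X)) \<partial>S.S \<partial>M)"
    by (subst S.nn_integral_fst) simp_all
  finally show ?thesis by simp
qed

text \<open>Independence of one coordinate from the rest: resampling coordinate \<open>i\<close>
  preserves the product law, and \<open>g\<close> does not see the change.\<close>

lemma nn_integral_PiM_update: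
  fixes i :: 'i
  assumes "prob_space M" and [measurable]: "f \<in> borel_measurable M"
    and [measurable]: "g \<in> borel_measurable (PiM UNIV (\<lambda>_::'i. M))"
    and g: "\<And>w a. g (w(i := a)) = g w"
  shows "(\<integral>\<^sup>+w. f (w i) * g w \<partial>PiM UNIV (\<lambda>_::'i. M)) =
    (\<integral>\<^sup>+a. f a \<partial>M) * (\<integral>\<^sup>+w. g w \<partial>PiM UNIV (\<lambda>_::'i. M))"
proof -
  interpret prob_space M by fact
  let ?P = "PiM UNIV (\<lambda>_::'i. M)"
  interpret P: prob_space ?P by (intro prob_space_PiM assms)
  have D: "?P = distr (M \<Otimes>\<^sub>M ?P) ?P (\<lambda>(x, X). X(i := x))"
    using distr_pair_PiM_eq_PiM[of UNIV "\<lambda>_. M" i] assms(1) by simp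
  have [measurable]: "(\<lambda>(x, X). X(i := x)) \<in> M \<Otimes>\<^sub>M ?P \<rightarrow>\<^sub>M ?P"
    using measurable_fun_upd[of UNIV UNIV i snd "M \<Otimes>\<^sub>M ?P" "\<lambda>_. M" fst]
    by (simp add: case_prod_beta')
  have "(\<integral>\<^sup>+w. f (w i) * g w \<partial>?P) = (\<integral>\<^sup>+z. f (fst z) * g (snd z) \<partial>(M \<Otimes>\<^sub>M ?P))"
    by (subst D, subst nn_integral_distr) (auto simp: case_prod_beta g)
  also have "\<dots> = (\<integral>\<^sup>+a. \<integral>\<^sup>+w. f a * g w \<partial>?P \<partial>M)"
    by (subst P.nn_integral_fst[symmetric]) simp_all
  also have "\<dots> = (\<integral>\<^sup>+a. f a \<partial>M) * (\<integral>\<^sup>+w. g w \<partial>?P)"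
    by (simp add: nn_integral_cmult nn_integral_multc)
  finally show ?thesis .
qed

abbreviation unif :: "real measure" where
  "unif \<equiv> uniform_measure lborel {0..1}"

lemma prob_space_unif: "prob_space unif"
  by (intro prob_space_uniform_measure) auto

lemma nn_integral_unif_if:
  assumes "0 \<le> p" "p \<le> 1"
  shows "(\<integral>\<^sup>+u. (if u < p then A else B) \<partial>unif) = ennreal p * A + ennreal (1 - p) * B"
proof -
  have 1: "{0..1} \<inter> {u. u < p} = {0..<p}" "{0..1} \<inter> {u. \<not> u < p} = {p..1}"
    using assms by auto
  have "(\<integral>\<^sup>+u. (if u < p then A else B) \<partial>unif) =
    (\<integral>\<^sup>+u. A * indicator {u. u < p} u + B * indicator {u. \<not> u < p} u \<partial>unif)"
    by (intro nn_integral_cong) (auto simp: indicator_def)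
  also have "\<dots> = A * emeasure unif {u. u < p} + B * emeasure unif {u. \<not> u < p}"
    by (subst nn_integral_add) (auto simp: nn_integral_cmult_indicator)
  also have "\<dots> = A * ennreal p + B * ennreal (1 - p)"
    using assms by (simp add: 1 divide_ennreal_def del: not_less)
  finally show ?thesis by (simp add: mult.commute)
qed

text \<open>The walk is at \<open>x\<close> and has already made \<open>l y\<close> left steps from each site \<open>y\<close>; \<open>gain\<close> pays
  \<open>F\<close> of the left-step counts if \<open>n\<close> is reached within the next \<open>N\<close> steps, and nothing otherwise.\<close>

primrec gain :: "(int \<Rightarrow> real) \<Rightarrow> int \<Rightarrow> ((int \<Rightarrow> nat) \<Rightarrow> ennreal) \<Rightarrow> nat \<Rightarrow>
    (int \<Rightarrow> nat) \<Rightarrow> int \<Rightarrow> (nat \<Rightarrow> real) \<Rightarrow> ennreal" where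
  "gain w n F 0 l x U = (if x = n then F l else 0)"
| "gain w n F (Suc N) l x U = (if x = n then F l
     else if U 0 < w x then gain w n F N l (x + 1) (\<lambda>k. U (Suc k))
     else gain w n F N (l(x := Suc (l x))) (x - 1) (\<lambda>k. U (Suc k)))"

text \<open>\<open>F\<close> may be arbitrary: within \<open>N\<close> steps it is evaluated only at
  finitely many fixed count functions, and \<open>z\<close> merely selects the branch.\<close>

lemma measurable_gain:
  assumes "\<And>x. (\<lambda>z. f z x) \<in> borel_measurable M" and "\<And>k. (\<lambda>z. g z k) \<in> borel_measurable M"
  shows "(\<lambda>z. gain (f z) n F N l x (g z)) \<in> borel_measurable M"
  using assms
proof (induction N arbitrary: l x g)
  case (Suc N)
  note [measurable] = Suc.prems Suc.IH[of "\<lambda>z k. g z (Suc k)", OF Suc.prems(1) Suc.prems(2)]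
  show ?case by simp
qed simp

lemma borel_measurable_component_PiM:
  assumes "sets M = sets borel"
  shows "(\<lambda>w. w x) \<in> borel_measurable (PiM UNIV (\<lambda>_. M))"
proof -
  have "(\<lambda>w. w x) \<in> PiM UNIV (\<lambda>_. M) \<rightarrow>\<^sub>M M"
    by (rule measurable_component_singleton) simp
  then show ?thesis
    unfolding measurable_cong_sets[OF refl assms] .
qed

lemma measurable_gain_unif [measurable]:
  "gain w n F N l x \<in> borel_measurable (PiM UNIV (\<lambda>_. unif))"
  by (rule measurable_gain) (auto intro!: borel_measurable_component_PiM)

lemma nn_integral_gain_Suc:
  assumes "0 \<le> w x" "w x \<le> 1" "x \<noteq> n"
  shows "(\<integral>\<^sup>+U. gain w n F (Suc N) l x U \<partial>PiM UNIV (\<lambda>_. unif)) =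
    ennreal (w x) * (\<integral>\<^sup>+U. gain w n F N l (x + 1) U \<partial>PiM UNIV (\<lambda>_. unif)) +
    ennreal (1 - w x) * (\<integral>\<^sup>+U. gain w n F N (l(x := Suc (l x))) (x - 1) U \<partial>PiM UNIV (\<lambda>_. unif))"
proof -
  have "(\<integral>\<^sup>+U. gain w n F (Suc N) l x U \<partial>PiM UNIV (\<lambda>_. unif)) =
    (\<integral>\<^sup>+u. (if u < w x then \<integral>\<^sup>+U. gain w n F N l (x + 1) U \<partial>PiM UNIV (\<lambda>_. unif)
       else \<integral>\<^sup>+U. gain w n F N (l(x := Suc (l x))) (x - 1) U \<partial>PiM UNIV (\<lambda>_. unif)) \<partial>unif)"
    using assms(3)
    by (subst nn_integral_PiM_case_nat[OF prob_space_unif measurable_gain_unif])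
       (auto intro!: nn_integral_cong)
  then show ?thesis using assms by (simp add: nn_integral_unif_if)
qed

lemma gain_mono: "gain w n F N l x U \<le> gain w n F (Suc N) l x U"
proof (induction N arbitrary: l x U)
  case (Suc N)
  show ?case
    by (subst (1 2) gain.simps(2)) (simp del: gain.simps(2) add: Suc)
qed simp

section \<open>Identification of the recursive reward with the walk\<close>

lemma loc_0: "loc w U 0 = (\<lambda>_. 0)"
  by (simp add: loc_def fun_eq_iff)

lemma loc_Suc: "loc w U (Suc t) = (if U t < w (walk w U t) then loc w U t
    else (loc w U t)(walk w U t := Suc (loc w U t (walk w U t))))"
proof -
  have *: "{s. s < Suc t \<and> walk w U s = x \<and> walk w U (Suc s) = x - 1} =
     (if walk w U t = x \<and> \<not> U t < w x
      then insert t {s. s < t \<and> walk w U s = x \<and> walk w U (Suc s) = x - 1}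
      else {s. s < t \<and> walk w U s = x \<and> walk w U (Suc s) = x - 1})" for x
    by (auto simp: less_Suc_eq split: if_splits)
  show ?thesis
    unfolding loc_def * by (auto simp: fun_eq_iff simp del: walk.simps)
qed

text \<open>At time \<open>t\<close> the state of the recursion is the pair of \<open>loc\<close>
  and \<open>walk\<close>. Since \<open>n\<close> was not visited before \<open>t\<close>, the first
  visit from \<open>t\<close> on is at time \<open>hit\<close>.\<close>

lemma gain_walk:
  assumes "\<And>s. s < t \<Longrightarrow> walk w U s \<noteq> int n"
  shows "gain w (int n) F N (loc w U t) (walk w U t) (\<lambda>k. U (t + k)) =
    (if \<exists>s\<le>t + N. walk w U s = int n then F (loc w U (hit w U n)) else 0)"
  using assms
proof (induction N arbitrary: t)
  case 0
  have "hit w U n = t" if "walk w U t = int n"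
    unfolding hit_def using that 0 by (intro Least_equality) (auto simp: not_less[symmetric])
  moreover have "(\<exists>s\<le>t. walk w U s = int n) \<longleftrightarrow> walk w U t = int n"
    using 0 by (metis le_neq_implies_less order_refl)
  ultimately show ?case by simp
next
  case (Suc N)
  show ?case
  proof (cases "walk w U t = int n")
    case True
    have "hit w U n = t"
      unfolding hit_def using True Suc.prems
      by (intro Least_equality) (auto simp: not_less[symmetric])
    then show ?thesis using True by auto
  next
    case False
    have "gain w (int n) F (Suc N) (loc w U t) (walk w U t) (\<lambda>k. U (t + k)) =
      gain w (int n) F N (loc w U (Suc t)) (walk w U (Suc t)) (\<lambda>k. U (Suc t + k))"
      using False by (simp add: loc_Suc)
    also have "\<dots> = (if \<exists>s\<le>Suc t + N. walk w U s = int n then F (loc w U (hit w U n)) else 0)"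
      using False Suc.prems by (intro Suc.IH) (auto simp: less_Suc_eq simp del: walk.simps)
    finally show ?thesis by simp
  qed
qed

text \<open>The reward appears once the horizon reaches the hitting time and then stays. A walk that
  never hits earns 0, so the unspecified value of \<open>hit\<close> does no harm.\<close>

lemma SUP_gain_walk:
  "(SUP N. gain w (int n) F N (\<lambda>_. 0) 0 U) =
    (if \<exists>s. walk w U s = int n then F (loc w U (hit w U n)) else 0)"
proof -
  have g: "gain w (int n) F N (\<lambda>_. 0) 0 U =
      (if \<exists>s\<le>N. walk w U s = int n then F (loc w U (hit w U n)) else 0)" for N
    using gain_walk[of 0 w U n F N] by (simp add: loc_0)
  show ?thesis
  proof (cases "\<exists>s. walk w U s = int n")
    case True
    then obtain s where s: "walk w U s = int n" by blast
    let ?c = "F (loc w U (hit w U n))"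
    have "(SUP N. if \<exists>s\<le>N. walk w U s = int n then ?c else 0) \<le> ?c"
      by (intro SUP_least) auto
    moreover have "?c \<le> (SUP N. if \<exists>s\<le>N. walk w U s = int n then ?c else 0)"
      by (rule SUP_upper2[of s]) (use s in auto)
    ultimately show ?thesis using True by (simp only: g if_True antisym)
  qed (simp add: g)
qed

text \<open>Failures before the \<open>k\<close>-th success. For \<open>k = 0\<close> the truncated subtraction makes this the point
  mass at 0, as needed.\<close>

definition nb :: "nat \<Rightarrow> real \<Rightarrow> nat \<Rightarrow> ennreal" where
  "nb k p j = ennreal (real ((j + k - 1) choose j) * p ^ k * (1 - p) ^ j)"

lemma nb_0: "nb 0 p j = (if j = 0 then 1 else 0)"
  by (cases j) (auto simp: nb_def binomial_eq_0)

lemma measurable_nb [measurable]: "(\<lambda>p. nb k p j) \<in> borel_measurable borel"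
  unfolding nb_def by measurable

lemma nb_Suc_0: "0 \<le> p \<Longrightarrow> nb (Suc k) p 0 = ennreal p * nb k p 0"
  by (simp add: nb_def ennreal_mult)

text \<open>Conditioning on the first trial; for the coefficients this is Pascal's rule.\<close>

lemma nb_Suc_Suc:
  assumes "0 \<le> p" "p \<le> 1"
  shows "nb (Suc k) p (Suc j) = ennreal p * nb k p (Suc j) + ennreal (1 - p) * nb (Suc k) p j"
proof -
  have "nb (Suc k) p (Suc j) = ennreal (p * (real ((j + k) choose Suc j) * p ^ k * (1 - p) ^ Suc j)
     + (1 - p) * (real ((j + k) choose j) * p ^ Suc k * (1 - p) ^ j))"
    by (simp add: nb_def algebra_simps)
  then show ?thesis
    using assms by (simp add: nb_def ennreal_mult ennreal_plus)
qed

lemma nb_first_step: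
  assumes "0 \<le> p" "p \<le> 1"
  shows "(\<Sum>j. nb (Suc k) p j * A j) =
    ennreal p * (\<Sum>j. nb k p j * A j) + ennreal (1 - p) * (\<Sum>j. nb (Suc k) p j * A (Suc j))"
proof -
  have sp: "(\<Sum>j. f j) = f 0 + (\<Sum>j. f (Suc j))" for f :: "nat \<Rightarrow> ennreal"
    using suminf_offset[of f 1] by (simp add: summableI)
  have "(\<Sum>j. nb (Suc k) p j * A j) = ennreal p * nb k p 0 * A 0 +
     (\<Sum>j. ennreal p * (nb k p (Suc j) * A (Suc j)) + ennreal (1 - p) * (nb (Suc k) p j * A (Suc j)))"
    by (subst sp) (simp only: nb_Suc_0[OF assms(1)] nb_Suc_Suc[OF assms] distrib_right mult.assoc)
  also have "\<dots> = ennreal p * (nb k p 0 * A 0) + ennreal p * (\<Sum>j. nb k p (Suc j) * A (Suc j)) +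
     ennreal (1 - p) * (\<Sum>j. nb (Suc k) p j * A (Suc j))"
    by (simp add: suminf_add[symmetric] summableI ennreal_suminf_cmult add.assoc mult.assoc)
  also have "\<dots> = ennreal p * (\<Sum>j. nb k p j * A j) + ennreal (1 - p) * (\<Sum>j. nb (Suc k) p j * A (Suc j))"
    by (simp only: sp[of "\<lambda>j. nb k p j * A j"] distrib_left)
  finally show ?thesis .
qed

text \<open>The expected product of \<open>\<phi>\<close> over the final left-step counts at the sites \<open>m, \<dots>, 0\<close>, given the current
  state \<open>(l, x)\<close> and \<open>d\<close> further left steps to come from site \<open>m\<close>. Each of those must be undone by a right step
  from \<open>m - 1\<close>, and one more is needed there if the walk is now at or left of \<open>m - 1\<close>.\<close>

primrec chain :: "(nat \<Rightarrow> nat \<Rightarrow> ennreal) \<Rightarrow> (int \<Rightarrow> real) \<Rightarrow> nat \<Rightarrow> nat \<Rightarrow> (int \<Rightarrow> nat) \<Rightarrow> int \<Rightarrow> ennreal" where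
  "chain \<phi> w 0 d l x = 1"
| "chain \<phi> w (Suc y) d l x = (\<Sum>j. nb (d + (if x \<le> int y then 1 else 0)) (w (int y)) j *
     (\<phi> (l (int (Suc y)) + d) (l (int y) + j) * chain \<phi> w y j l x))"

lemma chain_cong:
  assumes "\<And>y. 0 \<le> y \<Longrightarrow> y \<le> int m \<Longrightarrow> l y = l' y"
    and "\<And>y. 0 \<le> y \<Longrightarrow> y < int m \<Longrightarrow> x \<le> y \<longleftrightarrow> x' \<le> y"
  shows "chain \<phi> w m d l x = chain \<phi> w m d l' x'"
  using assms
proof (induction m arbitrary: d)
  case (Suc m)
  have "chain \<phi> w m j l x = chain \<phi> w m j l' x'" for j
    using Suc.prems by (intro Suc.IH) auto
  moreover have "l (int (Suc m)) = l' (int (Suc m))" "l (int m) = l' (int m)" "x \<le> int m \<longleftrightarrow> x' \<le> int m"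
    using Suc.prems by auto
  ultimately show ?case by simp
qed simp

text \<open>A left step from \<open>x\<close> may be booked as made or as still to come. The final
  count at \<open>x\<close> agrees, and the extra right step owed from \<open>x - 1\<close> comes
  from the position on one side and from \<open>Suc j\<close> on the other.\<close>

lemma chain_left_below:
  "chain \<phi> w x j (l(int x := Suc (l (int x)))) (int x - 1) = chain \<phi> w x (Suc j) l (int x)"
proof (cases x)
  case (Suc y)
  have "chain \<phi> w y i (l(int x := Suc (l (int x)))) (int x - 1) = chain \<phi> w y i l (int x)" for i
    by (rule chain_cong) (auto simp: Suc)
  then show ?thesis by (simp add: Suc)
qed simp

text \<open>The next step is one trial at site \<open>x\<close>, where \<open>nb_first_step\<close>
  applies. Sites above \<open>x\<close> keep their weights for all three positions, so linearity
  suffices there; below \<open>x\<close>, \<open>chain_left_below\<close> matches the left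
  move.\<close>

lemma chain_harmonic_pos:
  assumes "0 \<le> w (int x)" "w (int x) \<le> 1" "x < m"
  shows "chain \<phi> w m d l (int x) = ennreal (w (int x)) * chain \<phi> w m d l (int x + 1) +
    ennreal (1 - w (int x)) * chain \<phi> w m d (l(int x := Suc (l (int x)))) (int x - 1)"
  using assms(3)
proof (induction m arbitrary: d)
  case (Suc m)
  let ?l = "l(int x := Suc (l (int x)))"
  show ?case
  proof (cases "m = x")
    case True
    have r: "chain \<phi> w x j l (int x + 1) = chain \<phi> w x j l (int x)" for j
      by (rule chain_cong) auto
    show ?thesis
      unfolding True chain.simps(2) r chain_left_below
      using nb_first_step[OF assms(1,2), of d "\<lambda>j. \<phi> (l (int (Suc x)) + d) (l (int x) + j) * chain \<phi> w x j l (int x)"]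
      by simp
  next
    case False
    then have "x < m" using Suc.prems by simp
    then show ?thesis
      using Suc.IH[OF \<open>x < m\<close>]
      by (simp add: distrib_left suminf_add[symmetric] summableI ennreal_suminf_cmult[symmetric] mult_ac
          del: ennreal_suminf_cmult)
  qed
qed simp

lemma chain_harmonic:
  assumes "0 \<le> w x" "w x \<le> 1" "x < int m"
  shows "chain \<phi> w m d l x = ennreal (w x) * chain \<phi> w m d l (x + 1) +
    ennreal (1 - w x) * chain \<phi> w m d (l(x := Suc (l x))) (x - 1)"
proof (cases "0 \<le> x")
  case True
  then obtain k where "x = int k" using nonneg_int_cases by blast
  then show ?thesis using chain_harmonic_pos[of w k m] assms by simp
next
  case False
  \<comment> \<open>Left of 0 neither move affects a count or a comparison that \<open>chain\<close>
    reads.\<close>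
  have "chain \<phi> w m d l (x + 1) = chain \<phi> w m d l x"
    "chain \<phi> w m d (l(x := Suc (l x))) (x - 1) = chain \<phi> w m d l x"
    by (rule chain_cong; use False in auto)+
  then show ?thesis
    using assms by (simp add: distrib_right[symmetric] ennreal_plus[symmetric] del: ennreal_plus)
qed

text \<open>With nothing pending and the walk at or right of \<open>m\<close>, no site owes a right
  step: each \<open>nb\<close> is the point mass at 0 and the counts are final.\<close>

lemma chain_at_end:
  assumes "int m \<le> x"
  shows "chain \<phi> w m 0 l x = (\<Prod>y<m. \<phi> (l (int (Suc y))) (l (int y)))"
  using assms
proof (induction m)
  case (Suc m)
  have "chain \<phi> w (Suc m) 0 l x = (\<Sum>j. if j = 0 then \<phi> (l (int (Suc m))) (l (int m)) * chain \<phi> w m 0 l x else 0)"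
    using Suc.prems by (simp add: nb_0) (rule suminf_cong, simp)
  also have "\<dots> = \<phi> (l (int (Suc m))) (l (int m)) * chain \<phi> w m 0 l x"
    by (subst suminf_finite[of "{0}"]) auto
  finally show ?case using Suc by (simp add: mult.commute)
qed simp

text \<open>\<open>chain\<close> is harmonic for the walk that also records its left steps, so it dominates the
  expected reward paid at the hitting time.\<close>

lemma nn_integral_gain_le_chain:
  fixes m :: nat
  assumes "\<And>x. 0 \<le> w x \<and> w x \<le> 1" and "x \<le> int m"
  shows "(\<integral>\<^sup>+U. gain w (int m) (\<lambda>l. \<Prod>y<m. \<phi> (l (int (Suc y))) (l (int y))) N l x U \<partial>PiM UNIV (\<lambda>_. unif))
    \<le> chain \<phi> w m 0 l x"
proof -
  let ?F = "\<lambda>l. \<Prod>y<m. \<phi> (l (int (Suc y))) (l (int y))"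
  interpret U: prob_space "PiM UNIV (\<lambda>_::nat. unif)"
    by (intro prob_space_PiM prob_space_unif)
  show ?thesis using assms(2)
  proof (induction N arbitrary: l x)
    case 0
    then show ?case by (auto simp: chain_at_end U.emeasure_space_1)
  next
    case (Suc N)
    show ?case
    proof (cases "x = int m")
      case True
      then show ?thesis by (simp add: chain_at_end U.emeasure_space_1)
    next
      case False
      then have "x < int m" using Suc.prems by simp
      have "(\<integral>\<^sup>+U. gain w (int m) ?F (Suc N) l x U \<partial>PiM UNIV (\<lambda>_. unif)) \<le>
        ennreal (w x) * chain \<phi> w m 0 l (x + 1) +
        ennreal (1 - w x) * chain \<phi> w m 0 (l(x := Suc (l x))) (x - 1)"
        unfolding nn_integral_gain_Suc[OF conjunct1[OF assms(1)] conjunct2[OF assms(1)] False]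
        using \<open>x < int m\<close> by (intro add_mono mult_left_mono Suc.IH) auto
      also have "\<dots> = chain \<phi> w m 0 l x"
        using assms(1) \<open>x < int m\<close> by (intro chain_harmonic[symmetric]) auto
      finally show ?thesis .
    qed
  qed
qed

lemma nn_integral_SUP_gain:
  "(\<integral>\<^sup>+U. (SUP N. gain w n F N l x U) \<partial>PiM UNIV (\<lambda>_. unif)) =
    (SUP N. \<integral>\<^sup>+U. gain w n F N l x U \<partial>PiM UNIV (\<lambda>_. unif))"
  by (rule nn_integral_monotone_convergence_SUP)
     (auto intro!: incseq_SucI le_funI gain_mono simp del: gain.simps)

section \<open>Escape probabilities\<close>

definition hit_prob :: "(int \<Rightarrow> real) \<Rightarrow> int \<Rightarrow> nat \<Rightarrow> int \<Rightarrow> ennreal" where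
  "hit_prob w n N x = (\<integral>\<^sup>+U. gain w n (\<lambda>_. 1) N (\<lambda>_. 0) x U \<partial>PiM UNIV (\<lambda>_. unif))"

lemma gain_const: "gain w n (\<lambda>_. c) N l x U = gain w n (\<lambda>_. c) N l' x U"
proof (induction N arbitrary: l l' x U)
  case (Suc N)
  show ?case
    using Suc[of l "x + 1" "\<lambda>k. U (Suc k)" l']
      Suc[of "l(x := Suc (l x))" "x - 1" "\<lambda>k. U (Suc k)" "l'(x := Suc (l' x))"]
    by (simp only: gain.simps)
qed simp

lemma gain_one_le: "gain w n (\<lambda>_. 1) N l x U \<le> 1"
  by (induction N arbitrary: l x U) auto

lemma hit_prob_le: "hit_prob w n N x \<le> 1"
proof -
  interpret U: prob_space "PiM UNIV (\<lambda>_::nat. unif)"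
    by (intro prob_space_PiM prob_space_unif)
  have "hit_prob w n N x \<le> (\<integral>\<^sup>+U. 1 \<partial>PiM UNIV (\<lambda>_::nat. unif))"
    unfolding hit_prob_def by (intro nn_integral_mono gain_one_le)
  then show ?thesis by (simp add: U.emeasure_space_1)
qed

lemma hit_prob_target: "hit_prob w n N n = 1"
proof -
  interpret U: prob_space "PiM UNIV (\<lambda>_::nat. unif)"
    by (intro prob_space_PiM prob_space_unif)
  have "gain w n (\<lambda>_. 1) N l n U = 1" for l U by (cases N) auto
  then show ?thesis by (simp add: hit_prob_def U.emeasure_space_1)
qed

lemma hit_prob_Suc:
  assumes "0 \<le> w x" "w x \<le> 1" "x \<noteq> n"
  shows "hit_prob w n (Suc N) x = ennreal (w x) * hit_prob w n N (x + 1) + ennreal (1 - w x) * hit_prob w n N (x - 1)"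
proof -
  have "gain w n (\<lambda>_. 1) N ((\<lambda>_. 0)(x := Suc 0)) y = gain w n (\<lambda>_. 1) N (\<lambda>_. 0) y" for y
    by (rule ext) (rule gain_const)
  then show ?thesis
    unfolding hit_prob_def nn_integral_gain_Suc[of w x n, OF assms] by simp
qed

lemma hit_prob_mono: "hit_prob w n N x \<le> hit_prob w n (Suc N) x"
  unfolding hit_prob_def by (intro nn_integral_mono gain_mono)

text \<open>Letting the horizon tend to infinity turns the recursion into a harmonic equation; it is
  stated in the reals so that complements can be taken.\<close>

lemma hit_prob_limit_harmonic:
  assumes "0 \<le> w x" "w x \<le> 1" "x \<noteq> n"
  shows "enn2real (SUP N. hit_prob w n N x) = w x * enn2real (SUP N. hit_prob w n N (x + 1)) +
    (1 - w x) * enn2real (SUP N. hit_prob w n N (x - 1))"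
proof -
  have fin: "hit_prob w n N x < top" for N x
    using hit_prob_le[of w n N x] by (rule le_less_trans) simp
  have lim: "(\<lambda>N. enn2real (hit_prob w n N x)) \<longlonglongrightarrow> enn2real (SUP N. hit_prob w n N x)" for x
  proof (rule tendsto_enn2real)
    have "(SUP N. hit_prob w n N x) \<le> 1" by (intro SUP_least hit_prob_le)
    then show "(\<lambda>N. hit_prob w n N x) \<longlonglongrightarrow> ennreal (enn2real (SUP N. hit_prob w n N x))"
      by (subst ennreal_enn2real) (auto intro!: LIMSEQ_SUP incseq_SucI hit_prob_mono intro: le_less_trans)
  qed simp
  have "enn2real (hit_prob w n (Suc N) x) =
      w x * enn2real (hit_prob w n N (x + 1)) + (1 - w x) * enn2real (hit_prob w n N (x - 1))" for N
    using assms fin by (simp add: hit_prob_Suc enn2real_plus enn2real_mult ennreal_mult_less_top)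
  then have "(\<lambda>N. enn2real (hit_prob w n (Suc N) x)) \<longlonglongrightarrow>
      w x * enn2real (SUP N. hit_prob w n N (x + 1)) + (1 - w x) * enn2real (SUP N. hit_prob w n N (x - 1))"
    by (simp only:) (intro tendsto_intros lim)
  then show ?thesis
    using LIMSEQ_unique LIMSEQ_Suc[OF lim] by blast
qed

text \<open>The increments of \<open>v\<close> to the left of \<open>n\<close> are \<open>v (n - 1)\<close> times the terms of the series, so a
  bounded \<open>v\<close> and a divergent series force \<open>v (n - 1) = 0\<close>.\<close>

lemma harmonic_eq_0_left_of_target:
  fixes v :: "int \<Rightarrow> real"
  assumes w: "\<And>x. 0 < w x \<and> w x < 1" and v: "\<And>x. 0 \<le> v x \<and> v x \<le> 1" and n: "v n = 0"
    and harm: "\<And>x. x < n \<Longrightarrow> v x = w x * v (x + 1) + (1 - w x) * v (x - 1)"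
    and div: "(\<Sum>k. ennreal (\<Prod>j<k. w (n - 1 - int j) / (1 - w (n - 1 - int j)))) = \<infinity>"
  shows "v (n - int m) = 0"
proof -
  define r where "r j = w (n - 1 - int j) / (1 - w (n - 1 - int j))" for j
  have r0: "0 \<le> r j" for j using w by (simp add: r_def less_imp_le)
  \<comment> \<open>Harmonicity written for increments: moving one site left multiplies the
    increment by \<open>r k\<close>.\<close>
  have step: "v (n - 1 - int k) - v (n - int k) = v (n - 1) * (\<Prod>j<k. r j)" for k
  proof (induction k)
    case (Suc k)
    let ?x = "n - 1 - int k"
    have "v ?x = w ?x * v (?x + 1) + (1 - w ?x) * v (?x - 1)" by (rule harm) simp
    then have "(1 - w ?x) * (v (?x - 1) - v ?x) = w ?x * (v ?x - v (?x + 1))"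
      by (simp add: algebra_simps)
    then have "v (?x - 1) - v ?x = r k * (v ?x - v (?x + 1))"
      using w[of ?x] by (simp add: r_def field_simps)
    also have "v ?x - v (?x + 1) = v (n - 1) * (\<Prod>j<k. r j)"
      using Suc by (simp add: algebra_simps)
    finally show ?case by (simp add: algebra_simps)
  qed (simp add: n)
  have sum: "v (n - int k) = v (n - 1) * (\<Sum>i<k. \<Prod>j<i. r j)" for k
  proof (induction k)
    case (Suc k)
    show ?case using step[of k] Suc by (simp add: algebra_simps)
  qed (simp add: n)
  have "v (n - 1) = 0"
  proof (rule ccontr)
    assume "v (n - 1) \<noteq> 0"
    then have pos: "v (n - 1) > 0" using v[of "n - 1"] by simp
    have "summable (\<lambda>i. \<Prod>j<i. r j)"
    proof (rule summableI_nonneg_bounded)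
      show "0 \<le> (\<Prod>j<i. r j)" for i by (intro prod_nonneg) (simp add: r0)
      show "(\<Sum>i<k. \<Prod>j<i. r j) \<le> 1 / v (n - 1)" for k
        using sum[of k] v[of "n - int k"] pos by (simp add: field_simps)
    qed
    then have "(\<Sum>k. ennreal (\<Prod>j<k. r j)) < \<infinity>"
      by (subst suminf_ennreal2) (auto intro!: prod_nonneg simp: r0)
    with div show False by (simp add: r_def)
  qed
  with sum show ?thesis by simp
qed

lemma nn_integral_SUP_gain_one:
  assumes w: "\<And>x. 0 < w x \<and> w x < 1"
    and div: "(\<Sum>k. ennreal (\<Prod>j<k. w (int n - 1 - int j) / (1 - w (int n - 1 - int j)))) = \<infinity>"
  shows "(\<integral>\<^sup>+U. (SUP N. gain w (int n) (\<lambda>_. 1) N (\<lambda>_. 0) 0 U) \<partial>PiM UNIV (\<lambda>_. unif)) = 1"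
proof -
  let ?p = "\<lambda>x. SUP N. hit_prob w (int n) N x"
  have le1: "?p x \<le> 1" for x by (intro SUP_least hit_prob_le)
  have ne_top: "?p x < top" for x by (rule le_less_trans[OF le1]) simp
  \<comment> \<open>The starting site 0 is written as the site at distance \<open>m = n\<close> to
    the left of the target.\<close>
  have "1 - enn2real (?p (int n - int n)) = 0"
  proof (rule harmonic_eq_0_left_of_target[of w "\<lambda>x. 1 - enn2real (?p x)" "int n" n, OF w _ _ _ div])
    show "0 \<le> 1 - enn2real (?p x) \<and> 1 - enn2real (?p x) \<le> 1" for x
      using enn2real_mono[OF le1, of x] by simp
    show "1 - enn2real (?p (int n)) = 0" by (simp add: hit_prob_target)
    show "1 - enn2real (?p x) = w x * (1 - enn2real (?p (x + 1))) + (1 - w x) * (1 - enn2real (?p (x - 1)))"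
      if "x < int n" for x
      by (subst hit_prob_limit_harmonic) (use w[of x] that in \<open>auto simp: algebra_simps\<close>)
  qed
  then have "?p 0 = 1"
    using ne_top[of 0] by (metis diff_self eq_iff_diff_eq_0 ennreal_1 ennreal_enn2real)
  then show ?thesis
    unfolding nn_integral_SUP_gain by (simp add: hit_prob_def)
qed

section \<open>Divergence of the random series\<close>

text \<open>The series \<open>W\<close> satisfies \<open>W = 1 + r W'\<close> in law with \<open>W'\<close> an independent copy. On \<open>W' < \<infinity>\<close>
  this gives \<open>ln W - ln W' > ln r\<close>, whereas by stationarity (after truncation) \<open>ln W - ln W'\<close> has
  nonpositive mean.\<close>

lemma perpetuity_infinite:
  fixes r :: "'a \<Rightarrow> real"
  assumes "prob_space M" and [measurable]: "r \<in> borel_measurable M"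
    and pos: "AE a in M. 0 < r a"
    and fin: "(\<integral>\<^sup>+a. ennreal (- ln (r a)) \<partial>M) < \<infinity>"
    and le: "(\<integral>\<^sup>+a. ennreal (- ln (r a)) \<partial>M) \<le> (\<integral>\<^sup>+a. ennreal (ln (r a)) \<partial>M)"
  shows "AE s in PiM UNIV (\<lambda>_::nat. M). (\<Sum>k. \<Prod>j<k. ennreal (r (s j))) = \<infinity>"
proof -
  let ?S = "PiM UNIV (\<lambda>_::nat. M)"
  interpret prob_space M by fact
  interpret S: prob_space ?S by (intro prob_space_PiM assms)
  define P where "P = M \<Otimes>\<^sub>M ?S"
  interpret P: pair_prob_space M ?S ..
  define W where "W s = (\<Sum>k. \<Prod>j<k. ennreal (r (s j)))" for s
  define T where "T z = 1 + ennreal (r (fst z)) * W (snd z)" for z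
  \<comment> \<open>A logarithm truncated at \<open>m\<close>, so that its integrals are finite. The
    value at \<open>top\<close> is set by hand because \<open>enn2real top\<close> is 0.\<close>
  define q where "q m w = (if w = top then real m else min (real m) (ln (enn2real w)))" for m :: nat and w
  define l where "l w = ln (enn2real w)" for w
  have [measurable]: "W \<in> borel_measurable ?S" unfolding W_def by measurable
  have [measurable]: "T \<in> borel_measurable P" unfolding T_def P_def by measurable
  have [measurable]: "(\<lambda>z. W (snd z)) \<in> borel_measurable P" "(\<lambda>z. r (fst z)) \<in> borel_measurable P"
    unfolding P_def by measurable
  have [measurable]: "q m \<in> borel_measurable borel" for m unfolding q_def by measurable
  have [measurable]: "l \<in> borel_measurable borel" unfolding l_def by measurable
  have fstsnd: "(\<integral>\<^sup>+z. f (fst z) * g (snd z) \<partial>P) = (\<integral>\<^sup>+a. f a \<partial>M) * (\<integral>\<^sup>+s. g s \<partial>?S)"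
    if [measurable]: "f \<in> borel_measurable M" "g \<in> borel_measurable ?S" for f g
    unfolding P_def
    by (subst S.nn_integral_fst[symmetric]) (simp_all add: nn_integral_cmult nn_integral_multc)
  \<comment> \<open>Splitting off the first variable gives the fixed-point equation; hence
    \<open>T\<close> has the law of \<open>W\<close>.\<close>
  have W_case: "W (case_nat a s) = 1 + ennreal (r a) * W s" for a s
  proof -
    have "W (case_nat a s) = 1 + (\<Sum>k. \<Prod>j<Suc k. ennreal (r (case_nat a s j)))"
      unfolding W_def
      by (subst suminf_offset[of _ 1]) (simp_all add: summableI)
    also have "(\<Sum>k. \<Prod>j<Suc k. ennreal (r (case_nat a s j))) = (\<Sum>k. ennreal (r a) * (\<Prod>j<k. ennreal (r (s j))))"
      by (intro suminf_cong) (simp add: prod.lessThan_Suc_shift del: prod.lessThan_Suc)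
    finally show ?thesis by (simp add: W_def ennreal_suminf_cmult)
  qed
  have T_ge: "1 \<le> T z" for z by (simp add: T_def)
  have W_ge: "1 \<le> W s" for s
  proof -
    have "case_nat (s 0) (\<lambda>k. s (Suc k)) = s" by (auto split: nat.split)
    then show ?thesis using W_case[of "s 0" "\<lambda>k. s (Suc k)"] by simp
  qed
  have q_bounds: "0 \<le> q m w" "q m w \<le> real m" if "1 \<le> w" for m w
  proof -
    have "1 \<le> enn2real w" if "w \<noteq> top"
      using enn2real_mono[OF \<open>1 \<le> w\<close>] that by (simp add: less_top)
    then show "0 \<le> q m w" "q m w \<le> real m" by (auto simp: q_def)
  qed
  have stationary: "(\<integral>\<^sup>+z. ennreal (q m (T z)) \<partial>P) = (\<integral>\<^sup>+z. ennreal (q m (W (snd z))) \<partial>P)" for m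
  proof -
    have "(\<integral>\<^sup>+z. ennreal (q m (W (snd z))) \<partial>P) = (\<integral>\<^sup>+s. ennreal (q m (W s)) \<partial>?S)"
      using fstsnd[of "\<lambda>_. 1" "\<lambda>s. ennreal (q m (W s))"] by (simp add: emeasure_space_1)
    also have "\<dots> = (\<integral>\<^sup>+a. \<integral>\<^sup>+s. ennreal (q m (T (a, s))) \<partial>?S \<partial>M)"
      by (subst nn_integral_PiM_case_nat[OF assms(1)]) (simp_all add: W_case T_def)
    also have "\<dots> = (\<integral>\<^sup>+z. ennreal (q m (T z)) \<partial>P)"
      unfolding P_def by (subst S.nn_integral_fst) (simp_all flip: P_def)
    finally show ?thesis by simp
  qed
  \<comment> \<open>Positive and negative parts of the truncated increment. Stationarity makes their
    integrals equal, since the truncated integrals are finite and cancel.\<close>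
  define dp where "dp m z = ennreal (q m (T z) - q m (W (snd z)))" for m z
  define dm where "dm m z = ennreal (q m (W (snd z)) - q m (T z))" for m z
  have [measurable]: "dp m \<in> borel_measurable P" "dm m \<in> borel_measurable P" for m
    unfolding dp_def dm_def by measurable
  have dp_dm: "(\<integral>\<^sup>+z. dp m z \<partial>P) = (\<integral>\<^sup>+z. dm m z \<partial>P)" for m
  proof -
    have fin_q: "(\<integral>\<^sup>+z. ennreal (q m (T z)) \<partial>P) < top"
    proof -
      have "(\<integral>\<^sup>+z. ennreal (q m (T z)) \<partial>P) \<le> (\<integral>\<^sup>+z. ennreal (real m) \<partial>P)"
        by (intro nn_integral_mono ennreal_leI q_bounds T_ge)
      also have "\<dots> < top" by (simp add: P_def P.emeasure_space_1 ennreal_mult_less_top)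
      finally show ?thesis .
    qed
    have eq: "dp m z + ennreal (q m (W (snd z))) = dm m z + ennreal (q m (T z))" for z
      using q_bounds(1)[OF T_ge[of z], of m] q_bounds(1)[OF W_ge[of "snd z"], of m]
      by (cases "q m (T z) \<le> q m (W (snd z))")
         (auto simp: dp_def dm_def ennreal_neg ennreal_plus[symmetric] simp del: ennreal_plus)
    have "(\<integral>\<^sup>+z. dp m z \<partial>P) + (\<integral>\<^sup>+z. ennreal (q m (W (snd z))) \<partial>P) =
       (\<integral>\<^sup>+z. dm m z \<partial>P) + (\<integral>\<^sup>+z. ennreal (q m (T z)) \<partial>P)"
      by (subst (1 2) nn_integral_add[symmetric]) (simp_all add: eq)
    then show ?thesis
      using fin_q by (auto simp: stationary add.commute[of _ "\<integral>\<^sup>+z. ennreal (q m (W (snd z))) \<partial>P"])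
  qed
  define I :: "'a \<times> (nat \<Rightarrow> 'a) \<Rightarrow> ennreal" where "I z = (if W (snd z) = top then 0 else 1)" for z
  have [measurable]: "I \<in> borel_measurable P" unfolding I_def by measurable
  define Dp where "Dp z = I z * ennreal (l (T z) - l (W (snd z)))" for z
  define Dm where "Dm z = I z * ennreal (l (W (snd z)) - l (T z))" for z
  define e where "e z = I z * ennreal (l (T z) - l (W (snd z)) - ln (r (fst z)))" for z
  have [measurable]: "Dp \<in> borel_measurable P" "Dm \<in> borel_measurable P" "e \<in> borel_measurable P"
    unfolding Dp_def Dm_def e_def by measurable
  have T_top: "T z \<noteq> top" if "W (snd z) \<noteq> top" for z
    using that by (auto simp: T_def ennreal_mult_eq_top_iff)
  have "AE z in P. 0 < r (fst z)"
  proof -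
    have "AE a in M. AE s in ?S. 0 < r (fst (a, s))" using pos by simp
    then show ?thesis unfolding P_def by (intro P.AE_pair_measure) auto
  qed note rpos = this
  \<comment> \<open>If \<open>W\<close> is infinite, its truncation is already the cap and
    \<open>dp\<close> is 0; otherwise raising the cap can only widen a positive difference.\<close>
  have inc: "dp m z \<le> dp (Suc m) z" for m z
  proof (cases "W (snd z) = top")
    case True
    then have "dp m z = 0"
      by (simp add: dp_def q_def ennreal_neg)
    then show ?thesis by simp
  next
    case False
    then show ?thesis
      using T_top[OF False] by (auto simp: dp_def q_def ennreal_le_iff2 min_def)
  qed
  have Dp_le: "Dp z \<le> (SUP m. dp m z)" for z
  proof (cases "W (snd z) = top")
    case False
    obtain m where m: "max (l (T z)) (l (W (snd z))) \<le> real m" using real_arch_simple by blast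
    have "Dp z \<le> dp m z"
      using False m T_top[OF False] by (simp add: Dp_def I_def dp_def q_def l_def)
    then show ?thesis by (rule SUP_upper2[OF UNIV_I])
  qed (simp add: Dp_def I_def)
  \<comment> \<open>Positivity of \<open>r\<close> matters where \<open>W\<close> is infinite: then
    \<open>T\<close> is infinite too and both truncations equal \<open>m\<close>. Elsewhere
    truncation shrinks differences.\<close>
  have Dm_ge: "AE z in P. dm m z \<le> Dm z" for m
    using rpos
  proof eventually_elim
    case (elim z)
    show ?case
    proof (cases "W (snd z) = top")
      case True
      with elim have "T z = top" by (simp add: T_def ennreal_mult_top)
      with True show ?thesis by (simp add: dm_def q_def)
    next
      case False
      then show ?thesis
        using T_top[OF False] by (auto simp: dm_def Dm_def I_def q_def l_def ennreal_le_iff2 min_def)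
    qed
  qed
  have "(\<integral>\<^sup>+z. Dp z \<partial>P) \<le> (\<integral>\<^sup>+z. (SUP m. dp m z) \<partial>P)"
    by (intro nn_integral_mono Dp_le)
  also have "\<dots> = (SUP m. \<integral>\<^sup>+z. dp m z \<partial>P)"
    by (intro nn_integral_monotone_convergence_SUP incseq_SucI le_funI inc) simp
  also have "\<dots> \<le> (\<integral>\<^sup>+z. Dm z \<partial>P)"
    unfolding dp_dm by (intro SUP_least nn_integral_mono_AE Dm_ge)
  finally have Dp_Dm: "(\<integral>\<^sup>+z. Dp z \<partial>P) \<le> (\<integral>\<^sup>+z. Dm z \<partial>P)" .
  define Xp where "Xp z = I z * ennreal (ln (r (fst z)))" for z
  define Xm where "Xm z = I z * ennreal (- ln (r (fst z)))" for z
  have [measurable]: "Xp \<in> borel_measurable P" "Xm \<in> borel_measurable P"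
    unfolding Xp_def Xm_def by measurable
  \<comment> \<open>Drop the summand 1 from \<open>T = 1 + r W\<close>.\<close>
  have l_less: "ln (r (fst z)) + l (W (snd z)) < l (T z)" if r0: "0 < r (fst z)" and wf: "W (snd z) \<noteq> top" for z
  proof -
    obtain w where w: "W (snd z) = ennreal w" "1 \<le> w"
      using wf W_ge[of "snd z"] by (cases "W (snd z)") auto
    have Tz: "T z = ennreal (1 + r (fst z) * w)"
      using r0 w by (simp add: T_def ennreal_mult[symmetric] ennreal_plus[symmetric] del: ennreal_plus flip: ennreal_1)
    have "0 \<le> 1 + r (fst z) * w"
      using r0 w by simp
    then have "l (T z) = ln (1 + r (fst z) * w)"
      by (simp only: l_def Tz enn2real_ennreal)
    moreover have "ln (r (fst z)) + l (W (snd z)) = ln (r (fst z) * w)"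
      using r0 w by (simp add: l_def ln_mult)
    moreover have "ln (r (fst z) * w) < ln (1 + r (fst z) * w)"
      using r0 w by (subst ln_less_cancel_iff) (auto intro: mult_pos_pos add_pos_pos)
    ultimately show ?thesis by simp
  qed
  \<comment> \<open>The increment equals \<open>ln r\<close> plus the positive excess
    \<open>e\<close>, written with positive and negative parts on opposite sides to avoid
    subtraction in \<open>ennreal\<close>.\<close>
  have id: "AE z in P. Dp z + Xm z = Xp z + (Dm z + e z)"
    using rpos
  proof eventually_elim
    case (elim z)
    show ?case
    proof (cases "W (snd z) = top")
      case False
      let ?d = "l (T z) - l (W (snd z))" and ?x = "ln (r (fst z))"
      have "?x < ?d" using l_less[OF elim False] by simp
      then have "ennreal ?d + ennreal (- ?x) = ennreal ?x + (ennreal (- ?d) + ennreal (?d - ?x))"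
        by (cases "0 \<le> ?x"; cases "0 \<le> ?d")
           (auto simp: ennreal_neg ennreal_plus[symmetric] simp del: ennreal_plus)
      with False show ?thesis by (simp add: Dp_def Xm_def Xp_def Dm_def e_def I_def)
    qed (simp add: Dp_def Xm_def Xp_def Dm_def e_def I_def)
  qed
  \<comment> \<open>The probability that \<open>W\<close> is finite; by independence it factors out
    of the integrals of \<open>Xp\<close> and \<open>Xm\<close>.\<close>
  define p where "p = (\<integral>\<^sup>+s. (if W s = top then 0 else 1) \<partial>?S)"
  have p: "p \<le> 1"
  proof -
    have "p \<le> (\<integral>\<^sup>+s. 1 \<partial>?S)" unfolding p_def by (intro nn_integral_mono) auto
    then show ?thesis by (simp add: S.emeasure_space_1)
  qed
  have Xp: "(\<integral>\<^sup>+z. Xp z \<partial>P) = (\<integral>\<^sup>+a. ennreal (ln (r a)) \<partial>M) * p"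
    unfolding p_def by (subst fstsnd[symmetric]) (auto intro!: nn_integral_cong simp: Xp_def I_def)
  have Xm: "(\<integral>\<^sup>+z. Xm z \<partial>P) = (\<integral>\<^sup>+a. ennreal (- ln (r a)) \<partial>M) * p"
    unfolding p_def by (subst fstsnd[symmetric]) (auto intro!: nn_integral_cong simp: Xm_def I_def)
  have Xm_le: "(\<integral>\<^sup>+z. Xm z \<partial>P) \<le> (\<integral>\<^sup>+z. Xp z \<partial>P)"
    unfolding Xp Xm by (intro mult_right_mono le) simp
  have Xm_fin: "(\<integral>\<^sup>+z. Xm z \<partial>P) < top"
    unfolding Xm using fin p by (intro ennreal_mult_less_top[THEN iffD2]) (auto intro: le_less_trans)
  \<comment> \<open>The increment exceeds \<open>ln r\<close>, so its negative part is dominated by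
    that of \<open>ln r\<close>. This supplies the finiteness needed for cancelling.\<close>
  have "(\<integral>\<^sup>+z. Dm z \<partial>P) \<le> (\<integral>\<^sup>+z. Xm z \<partial>P)"
  proof (rule nn_integral_mono_AE)
    show "AE z in P. Dm z \<le> Xm z"
      using rpos
    proof eventually_elim
      case (elim z)
      show ?case using l_less[OF elim]
        by (cases "W (snd z) = top") (auto simp: Dm_def Xm_def I_def intro!: ennreal_leI)
    qed
  qed
  then have Dm_fin: "(\<integral>\<^sup>+z. Dm z \<partial>P) < top" using Xm_fin by (rule le_less_trans)
  \<comment> \<open>The drift hypothesis, the identity and \<open>Dp_Dm\<close> form a loop;
    cancelling the finite integrals of \<open>Xm\<close> and \<open>Dm\<close> leaves no mass for
    \<open>e\<close>, which is positive wherever \<open>W\<close> is finite.\<close>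
  have "((\<integral>\<^sup>+z. Xm z \<partial>P) + (\<integral>\<^sup>+z. Dm z \<partial>P)) + (\<integral>\<^sup>+z. e z \<partial>P) \<le> (\<integral>\<^sup>+z. Xp z \<partial>P) + ((\<integral>\<^sup>+z. Dm z \<partial>P) + (\<integral>\<^sup>+z. e z \<partial>P))"
    unfolding add.assoc by (intro add_right_mono Xm_le)
  also have "\<dots> = (\<integral>\<^sup>+z. Dp z \<partial>P) + (\<integral>\<^sup>+z. Xm z \<partial>P)"
    using nn_integral_cong_AE[OF id] by (simp add: nn_integral_add)
  also have "\<dots> \<le> ((\<integral>\<^sup>+z. Xm z \<partial>P) + (\<integral>\<^sup>+z. Dm z \<partial>P)) + 0"
    using add_right_mono[OF Dp_Dm, of "(\<integral>\<^sup>+z. Xm z \<partial>P)"] by (simp add: add.commute)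
  finally have "((\<integral>\<^sup>+z. Xm z \<partial>P) + (\<integral>\<^sup>+z. Dm z \<partial>P)) + (\<integral>\<^sup>+z. e z \<partial>P) \<le> ((\<integral>\<^sup>+z. Xm z \<partial>P) + (\<integral>\<^sup>+z. Dm z \<partial>P)) + 0" .
  then have "(\<integral>\<^sup>+z. e z \<partial>P) = 0"
    unfolding ennreal_add_left_cancel_le using Xm_fin Dm_fin by auto
  then have "AE z in P. e z = 0"
    by (simp add: nn_integral_0_iff_AE)
  with rpos have "AE z in P. W (snd z) = top"
  proof eventually_elim
    case (elim z)
    show ?case
    proof (rule ccontr)
      assume "W (snd z) \<noteq> top"
      then show False
        using elim l_less[of z] by (auto simp: e_def I_def ennreal_eq_0_iff)
    qed
  qed
  then have "AE a in M. AE s in ?S. W (snd (a, s)) = top"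
    unfolding P_def by (rule P.AE_pair)
  then show ?thesis by (simp add: W_def AE_const)
qed

section \<open>Exponential moments\<close>

lemma suminf_nb:
  assumes "0 < p" "p < 1"
  shows "(\<Sum>j. nb k p j) = 1"
proof -
  have "(\<Sum>j. nb k p j) = (\<integral>\<^sup>+j. ennreal (pmf (neg_binomial_pmf k p) j) \<partial>count_space UNIV)"
    using assms by (simp add: nn_integral_count_space_nat nb_def pmf_neg_binomial)
  also have "\<dots> = 1" by (rule nn_integral_pmf_eq_1)
  finally show ?thesis .
qed

text \<open>The coefficient in \<open>nb\<close> is exactly the denominator of \<open>Phi\<close>
  and cancels. The numerator is the coefficient for \<alpha> fewer successes and \<beta> fewer
  failures.\<close>

lemma nb_mult_Phi:
  assumes "0 \<le> p" "p \<le> 1" "\<alpha> \<le> d"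
  shows "nb (Suc d) p (j + \<beta>) * ennreal (Phi \<alpha> \<beta> d (j + \<beta>)) =
    ennreal (p ^ \<alpha> * (1 - p) ^ \<beta>) * nb (Suc (d - \<alpha>)) p j"
proof -
  have 1: "((j + \<beta> + d) choose (j + \<beta>)) = ((d + (j + \<beta>)) choose d)"
    by (subst binomial_symmetric) (simp_all add: add.commute)
  have 2: "d + (j + \<beta>) - (\<alpha> + \<beta>) = j + (d - \<alpha>)" using assms by simp
  have 3: "(j + (d - \<alpha>)) choose (d - \<alpha>) = (j + (d - \<alpha>)) choose j"
    by (subst binomial_symmetric) simp_all
  have 4: "p ^ Suc d = p ^ \<alpha> * p ^ Suc (d - \<alpha>)"
    using assms(3) by (simp only: power_add[symmetric]) simp
  define C where "C = real ((d + (j + \<beta>)) choose d)"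
  have "C > 0" by (simp add: C_def)
  define B where "B = real ((j + (d - \<alpha>)) choose j)"
  have nb1: "nb (Suc d) p (j + \<beta>) = ennreal (C * p ^ Suc d * (1 - p) ^ (j + \<beta>))"
    using 1 by (simp add: nb_def C_def)
  have nb2: "nb (Suc (d - \<alpha>)) p j = ennreal (B * p ^ Suc (d - \<alpha>) * (1 - p) ^ j)"
    by (simp add: nb_def B_def)
  have Phi: "Phi \<alpha> \<beta> d (j + \<beta>) = B / C"
    unfolding Phi_def 2 3 B_def C_def using assms(3) by simp
  have "(C * p ^ Suc d * (1 - p) ^ (j + \<beta>)) * (B / C) =
      (p ^ \<alpha> * (1 - p) ^ \<beta>) * (B * p ^ Suc (d - \<alpha>) * (1 - p) ^ j)"
    unfolding 4 using \<open>C > 0\<close> by (simp add: power_add)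
  moreover have "0 \<le> C * p ^ Suc d * (1 - p) ^ (j + \<beta>)" "0 \<le> B / C"
      "0 \<le> p ^ \<alpha> * (1 - p) ^ \<beta>" "0 \<le> B * p ^ Suc (d - \<alpha>) * (1 - p) ^ j"
    using assms \<open>C > 0\<close> by (simp_all add: B_def)
  ultimately show ?thesis
    unfolding nb1 nb2 Phi by (simp only: ennreal_mult[symmetric])
qed

lemma suminf_nb_Phi:
  assumes "0 < p" "p < 1"
  shows "(\<Sum>j. nb (Suc d) p j * ennreal (Phi \<alpha> \<beta> d j)) =
    ennreal (if \<alpha> \<le> d then p ^ \<alpha> * (1 - p) ^ \<beta> else 0)"
proof (cases "\<alpha> \<le> d")
  case True
  have "(\<Sum>j. nb (Suc d) p j * ennreal (Phi \<alpha> \<beta> d j)) =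
     (\<Sum>j. nb (Suc d) p (j + \<beta>) * ennreal (Phi \<alpha> \<beta> d (j + \<beta>)))"
    by (subst suminf_offset[of _ \<beta>]) (simp_all add: summableI Phi_def)
  also have "\<dots> = ennreal (p ^ \<alpha> * (1 - p) ^ \<beta>)"
    using assms True by (simp add: nb_mult_Phi ennreal_suminf_cmult suminf_nb)
  finally show ?thesis using True by simp
qed (simp add: Phi_def)

lemma Phi_nonneg: "0 \<le> Phi \<alpha> \<beta> i j"
  by (simp add: Phi_def)

text \<open>The product of the two binomials is the term \<open>k = \<alpha>\<close> of
  Vandermonde's sum for \<open>(i + j) choose i\<close>.\<close>

lemma Phi_le: "Phi \<alpha> \<beta> i j \<le> 1 / real ((\<alpha> + \<beta>) choose \<alpha>)"
proof (cases "\<alpha> \<le> i \<and> \<beta> \<le> j")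
  case True
  have "((\<alpha> + \<beta>) choose \<alpha>) * ((i + j - (\<alpha> + \<beta>)) choose (i - \<alpha>)) \<le>
     (\<Sum>k\<le>i. ((\<alpha> + \<beta>) choose k) * ((i + j - (\<alpha> + \<beta>)) choose (i - k)))"
    by (rule member_le_sum) (use True in auto)
  also have "\<dots> = (i + j) choose i"
    using True vandermonde[of "\<alpha> + \<beta>" "i + j - (\<alpha> + \<beta>)" i] by simp
  finally have "real ((\<alpha> + \<beta>) choose \<alpha>) * real ((i + j - (\<alpha> + \<beta>)) choose (i - \<alpha>)) \<le> real ((i + j) choose i)"
    by (metis of_nat_le_iff of_nat_mult)
  moreover have "0 < real ((\<alpha> + \<beta>) choose \<alpha>)" "0 < real ((i + j) choose i)"
    by simp_all
  ultimately show ?thesis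
    using True by (simp add: Phi_def field_simps del: of_nat_0_less_iff)
qed (auto simp: Phi_def)

text \<open>Hoeffding's lemma for the discrete law with weights \<pi>. Zero mean is expressed
  through the nonnegative \<open>X - a\<close>, and a negative \<open>t\<close> is treated by
  passing to \<open>- X\<close>.\<close>

lemma Hoeffding_suminf:
  fixes X :: "nat \<Rightarrow> real"
  assumes p1: "(\<Sum>j. \<pi> j) = 1" and ab: "\<And>j. a \<le> X j \<and> X j \<le> b"
    and mean: "(\<Sum>j. \<pi> j * ennreal (X j - a)) = ennreal (- a)" and "a \<le> 0" and "t \<noteq> 0"
  shows "(\<Sum>j. \<pi> j * ennreal (exp (t * X j))) \<le> ennreal (exp (t\<^sup>2 * (b - a)\<^sup>2 / 8))"
proof -
  define M where "M = density (count_space UNIV) \<pi>"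
  have nn: "(\<integral>\<^sup>+j. f j \<partial>M) = (\<Sum>j. \<pi> j * f j)" for f
    unfolding M_def by (subst nn_integral_density) (auto simp: nn_integral_count_space_nat)
  interpret prob_space M
    using nn[of "\<lambda>_. 1"] p1 by (intro prob_spaceI) simp
  have [measurable]: "f \<in> borel_measurable M" for f :: "nat \<Rightarrow> real" by (simp add: M_def)
  have bd: "\<bar>X j\<bar> \<le> \<bar>a\<bar> + \<bar>b\<bar>" for j using ab[of j] by linarith
  have int: "integrable M X"
    by (rule integrable_const_bound[of _ "\<bar>a\<bar> + \<bar>b\<bar>"]) (use bd in auto)
  have "expectation (\<lambda>j. X j - a) = - a"
    using ab \<open>a \<le> 0\<close> by (subst integral_eq_nn_integral) (auto simp: nn mean)
  then have E: "expectation X = 0"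
    using int by (simp add: prob_space)
  show ?thesis
  proof (cases "t > 0")
    case True
    interpret B: interval_bounded_random_variable M X a b
      by unfold_locales (use ab in auto)
    show ?thesis using B.Hoeffdings_lemma_nn_integral_0[OF True E] by (simp add: nn)
  next
    case False
    interpret B: interval_bounded_random_variable M "\<lambda>j. - X j" "- b" "- a"
      by unfold_locales (use ab in auto)
    have "- t > 0" "expectation (\<lambda>j. - X j) = 0" using False \<open>t \<noteq> 0\<close> E by auto
    from B.Hoeffdings_lemma_nn_integral_0[OF this] show ?thesis by (simp add: nn)
  qed
qed

section \<open>Averaging over the environment\<close>

lemma chain_cong_env:
  assumes "\<And>y. y < m \<Longrightarrow> w (int y) = w' (int y)"
  shows "chain \<phi> w m d l x = chain \<phi> w' m d l x"
  using assms by (induction m arbitrary: d) simp_all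

lemma measurable_chain:
  assumes "sets \<nu> = sets borel"
  shows "(\<lambda>w. chain \<phi> w m d l x) \<in> borel_measurable (PiM UNIV (\<lambda>_::int. \<nu>))"
proof (induction m arbitrary: d)
  case (Suc m)
  note [measurable] = Suc borel_measurable_component_PiM[OF assms]
  show ?case by simp
qed simp

text \<open>The outermost weight uses the environment only at site \<open>m\<close>, the inner chain
  only at sites below, so the integral factorises. A bound \<open>K\<close> uniform in
  \<open>d\<close> is then paid once per site.\<close>

lemma nn_integral_chain_le:
  assumes "prob_space \<nu>" and sets: "sets \<nu> = sets borel"
    and K: "\<And>d. (\<Sum>j. (\<integral>\<^sup>+a. nb (Suc d) a j \<partial>\<nu>) * \<phi> d j) \<le> K"
  shows "(\<integral>\<^sup>+w. chain \<phi> w m d (\<lambda>_. 0) 0 \<partial>PiM UNIV (\<lambda>_::int. \<nu>)) \<le> K ^ m"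
proof -
  interpret P: prob_space "PiM UNIV (\<lambda>_::int. \<nu>)" by (intro prob_space_PiM assms)
  note [measurable] = borel_measurable_component_PiM[OF sets] measurable_chain[OF sets]
  have nb_meas: "(\<lambda>a. nb k a j) \<in> borel_measurable \<nu>" for k j
    using measurable_nb[of k j] by (simp add: measurable_cong_sets[OF sets refl])
  show ?thesis
  proof (induction m arbitrary: d)
    case 0
    then show ?case by (simp add: P.emeasure_space_1)
  next
    case (Suc m)
    let ?C = "\<lambda>j. \<integral>\<^sup>+w. chain \<phi> w m j (\<lambda>_. 0) 0 \<partial>PiM UNIV (\<lambda>_::int. \<nu>)"
    have "(\<integral>\<^sup>+w. chain \<phi> w (Suc m) d (\<lambda>_. 0) 0 \<partial>PiM UNIV (\<lambda>_::int. \<nu>)) =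
      (\<Sum>j. \<integral>\<^sup>+w. nb (Suc d) (w (int m)) j * (\<phi> d j * chain \<phi> w m j (\<lambda>_. 0) 0) \<partial>PiM UNIV (\<lambda>_::int. \<nu>))"
      by (simp add: nn_integral_suminf)
    also have "\<dots> = (\<Sum>j. (\<integral>\<^sup>+a. nb (Suc d) a j \<partial>\<nu>) * (\<phi> d j * ?C j))"
    proof (rule suminf_cong)
      fix j
      have "(\<integral>\<^sup>+w. nb (Suc d) (w (int m)) j * (\<phi> d j * chain \<phi> w m j (\<lambda>_. 0) 0) \<partial>PiM UNIV (\<lambda>_::int. \<nu>)) =
        (\<integral>\<^sup>+a. nb (Suc d) a j \<partial>\<nu>) * (\<integral>\<^sup>+w. \<phi> d j * chain \<phi> w m j (\<lambda>_. 0) 0 \<partial>PiM UNIV (\<lambda>_::int. \<nu>))"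
      proof (rule nn_integral_PiM_update[OF assms(1) nb_meas])
        fix w :: "int \<Rightarrow> real" and a
        have "chain \<phi> (w(int m := a)) m j (\<lambda>_. 0) 0 = chain \<phi> w m j (\<lambda>_. 0) 0"
          by (rule chain_cong_env) simp
        then show "\<phi> d j * chain \<phi> (w(int m := a)) m j (\<lambda>_. 0) 0 = \<phi> d j * chain \<phi> w m j (\<lambda>_. 0) 0"
          by simp
      qed measurable
      then show "(\<integral>\<^sup>+w. nb (Suc d) (w (int m)) j * (\<phi> d j * chain \<phi> w m j (\<lambda>_. 0) 0) \<partial>PiM UNIV (\<lambda>_::int. \<nu>)) =
        (\<integral>\<^sup>+a. nb (Suc d) a j \<partial>\<nu>) * (\<phi> d j * ?C j)"
        by (simp add: nn_integral_cmult)
    qed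
    also have "\<dots> \<le> (\<Sum>j. (\<integral>\<^sup>+a. nb (Suc d) a j \<partial>\<nu>) * (\<phi> d j * K ^ m))"
      by (intro suminf_le mult_left_mono Suc.IH summableI) auto
    also have "\<dots> = (\<Sum>j. (\<integral>\<^sup>+a. nb (Suc d) a j \<partial>\<nu>) * \<phi> d j) * K ^ m"
      by (simp add: mult.assoc[symmetric] ennreal_suminf_multc)
    also have "\<dots> \<le> K * K ^ m" by (intro mult_right_mono K) simp
    finally show ?case by simp
  qed
qed

text \<open>The martingale increment: the subtracted term is the conditional mean of
  \<open>Phi\<close> given the previous count \<open>i\<close>.\<close>

definition centred :: "real measure \<Rightarrow> nat \<Rightarrow> nat \<Rightarrow> nat \<Rightarrow> nat \<Rightarrow> real" where
  "centred \<nu> \<alpha> \<beta> i j = Phi \<alpha> \<beta> i j - (if \<alpha> \<le> i then mom \<nu> \<alpha> \<beta> else 0)"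

lemma mom_nn_integral:
  assumes "prob_space \<nu>" and sets: "sets \<nu> = sets borel" and AE: "AE a in \<nu>. 0 < a \<and> a < 1"
  shows "(\<integral>\<^sup>+a. ennreal (a ^ \<alpha> * (1 - a) ^ \<beta>) \<partial>\<nu>) = ennreal (mom \<nu> \<alpha> \<beta>)" "0 \<le> mom \<nu> \<alpha> \<beta>"
proof -
  interpret prob_space \<nu> by fact
  have [measurable]: "(\<lambda>a::real. a ^ \<alpha> * (1 - a) ^ \<beta>) \<in> borel_measurable \<nu>"
    by (subst measurable_cong_sets[OF sets refl]) measurable
  have 0: "AE a in \<nu>. 0 \<le> a ^ \<alpha> * (1 - a) ^ \<beta>"
    using AE by eventually_elim simp
  have "AE a in \<nu>. norm (a ^ \<alpha> * (1 - a) ^ \<beta>) \<le> 1"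
    using AE
  proof eventually_elim
    case (elim a)
    then have "a ^ \<alpha> * (1 - a) ^ \<beta> \<le> 1 * 1" by (intro mult_mono power_le_one) auto
    with elim show ?case by simp
  qed
  then have "integrable \<nu> (\<lambda>a. a ^ \<alpha> * (1 - a) ^ \<beta>)"
    by (intro integrable_const_bound) auto
  then show "(\<integral>\<^sup>+a. ennreal (a ^ \<alpha> * (1 - a) ^ \<beta>) \<partial>\<nu>) = ennreal (mom \<nu> \<alpha> \<beta>)"
    unfolding mom_def by (intro nn_integral_eq_integral 0)
  show "0 \<le> mom \<nu> \<alpha> \<beta>" unfolding mom_def by (intro integral_nonneg_AE 0)
qed

text \<open>Averaging \<open>nb\<close> over \<nu> gives the transition weights of the annealed
  chain. Subtracting the mean shifts the range of \<open>Phi\<close> without changing its length, so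
  the exponent is the same for every \<open>d\<close>.\<close>

lemma exp_centred_le:
  assumes "prob_space \<nu>" and sets: "sets \<nu> = sets borel" and AE: "AE a in \<nu>. 0 < a \<and> a < 1" and "t \<noteq> 0"
  shows "(\<Sum>j. (\<integral>\<^sup>+a. nb (Suc d) a j \<partial>\<nu>) * ennreal (exp (t * centred \<nu> \<alpha> \<beta> d j))) \<le>
    ennreal (exp (t\<^sup>2 * (1 / real ((\<alpha> + \<beta>) choose \<alpha>))\<^sup>2 / 8))"
proof -
  interpret prob_space \<nu> by fact
  have nb_meas [measurable]: "(\<lambda>a. nb k a j) \<in> borel_measurable \<nu>" for k j
    using measurable_nb[of k j] by (simp add: measurable_cong_sets[OF sets refl])
  let ?c = "1 / real ((\<alpha> + \<beta>) choose \<alpha>)" and ?m = "if \<alpha> \<le> d then mom \<nu> \<alpha> \<beta> else 0"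
  have "(\<Sum>j. \<integral>\<^sup>+a. nb (Suc d) a j \<partial>\<nu>) = (\<integral>\<^sup>+a. (\<Sum>j. nb (Suc d) a j) \<partial>\<nu>)"
    by (simp add: nn_integral_suminf)
  also have "\<dots> = (\<integral>\<^sup>+a. 1 \<partial>\<nu>)"
    using AE by (intro nn_integral_cong_AE) (auto simp: suminf_nb elim: eventually_mono)
  finally have 1: "(\<Sum>j. \<integral>\<^sup>+a. nb (Suc d) a j \<partial>\<nu>) = 1" by (simp add: emeasure_space_1)
  have "(\<Sum>j. (\<integral>\<^sup>+a. nb (Suc d) a j \<partial>\<nu>) * ennreal (Phi \<alpha> \<beta> d j)) =
    (\<integral>\<^sup>+a. (\<Sum>j. nb (Suc d) a j * ennreal (Phi \<alpha> \<beta> d j)) \<partial>\<nu>)"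
    by (simp add: nn_integral_suminf nn_integral_multc)
  also have "\<dots> = (\<integral>\<^sup>+a. ennreal (if \<alpha> \<le> d then a ^ \<alpha> * (1 - a) ^ \<beta> else 0) \<partial>\<nu>)"
    using AE by (intro nn_integral_cong_AE) (auto simp: suminf_nb_Phi elim: eventually_mono)
  also have "\<dots> = ennreal ?m"
    by (simp add: mom_nn_integral[OF assms(1-3)])
  finally have 2: "(\<Sum>j. (\<integral>\<^sup>+a. nb (Suc d) a j \<partial>\<nu>) * ennreal (Phi \<alpha> \<beta> d j)) = ennreal ?m" .
  have "(\<Sum>j. (\<integral>\<^sup>+a. nb (Suc d) a j \<partial>\<nu>) * ennreal (exp (t * centred \<nu> \<alpha> \<beta> d j))) \<le>
    ennreal (exp (t\<^sup>2 * ((?c - ?m) - (- ?m))\<^sup>2 / 8))"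
  proof (rule Hoeffding_suminf[OF 1])
    show "- ?m \<le> centred \<nu> \<alpha> \<beta> d j \<and> centred \<nu> \<alpha> \<beta> d j \<le> ?c - ?m" for j
      using Phi_nonneg[of \<alpha> \<beta> d j] Phi_le[of \<alpha> \<beta> d j] by (simp add: centred_def)
    show "(\<Sum>j. (\<integral>\<^sup>+a. nb (Suc d) a j \<partial>\<nu>) * ennreal (centred \<nu> \<alpha> \<beta> d j - - ?m)) = ennreal (- (- ?m))"
      using 2 by (simp add: centred_def)
    show "- ?m \<le> 0" using mom_nn_integral(2)[OF assms(1-3)] by simp
  qed fact
  then show ?thesis by simp
qed

section \<open>The annealed walk\<close>

lemma sum_reverse_nat:
  fixes g :: "nat \<Rightarrow> 'a::comm_monoid_add"
  shows "(\<Sum>x = 1..n. g x) = (\<Sum>y<n. g (n - y))"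
  by (rule sum.reindex_bij_witness[of _ "\<lambda>y. n - y" "\<lambda>x. n - x"]) auto

text \<open>Reading sites from right to left turns left-step counts into generations of
  \<open>Zn\<close>; the compensator is paid once for each generation counted by
  \<open>Nn\<close>.\<close>

lemma sum_centred_Zn:
  "(\<Sum>y<n. centred \<nu> \<alpha> \<beta> (loc w U (hit w U n) (int (Suc y))) (loc w U (hit w U n) (int y))) =
    (\<Sum>x = 1..n. Phi \<alpha> \<beta> (Zn w U n (x - 1)) (Zn w U n x)) - real (Nn \<alpha> w U n) * mom \<nu> \<alpha> \<beta>"
proof -
  have Z: "loc w U (hit w U n) (int y) = Zn w U n (n - y)"
      "loc w U (hit w U n) (int (Suc y)) = Zn w U n (n - y - 1)" if "y < n" for y
    using that by (auto simp: Zn_def of_nat_diff algebra_simps)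
  have "real (Nn \<alpha> w U n) * mom \<nu> \<alpha> \<beta> = (\<Sum>x\<in>{x\<in>{..<n}. \<alpha> \<le> Zn w U n x}. mom \<nu> \<alpha> \<beta>)"
    by (simp add: Nn_def)
  also have "\<dots> = (\<Sum>x<n. if \<alpha> \<le> Zn w U n x then mom \<nu> \<alpha> \<beta> else 0)"
    by (intro sum.inter_filter) simp
  also have "\<dots> = (\<Sum>x = 1..n. if \<alpha> \<le> Zn w U n (x - 1) then mom \<nu> \<alpha> \<beta> else 0)"
    by (rule sum.reindex_bij_witness[of _ "\<lambda>x. x - 1" Suc]) auto
  finally have "(\<Sum>x = 1..n. Phi \<alpha> \<beta> (Zn w U n (x - 1)) (Zn w U n x)) - real (Nn \<alpha> w U n) * mom \<nu> \<alpha> \<beta> =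
    (\<Sum>x = 1..n. centred \<nu> \<alpha> \<beta> (Zn w U n (x - 1)) (Zn w U n x))"
    by (simp add: centred_def sum_subtractf)
  moreover have "(\<Sum>y<n. centred \<nu> \<alpha> \<beta> (loc w U (hit w U n) (int (Suc y))) (loc w U (hit w U n) (int y))) =
    (\<Sum>x = 1..n. centred \<nu> \<alpha> \<beta> (Zn w U n (x - 1)) (Zn w U n x))"
    unfolding sum_reverse_nat by (intro sum.cong) (simp_all only: Z lessThan_iff)
  ultimately show ?thesis by simp
qed

lemma nn_integral_annealed:
  assumes "prob_space \<nu>" and [measurable]: "f \<in> borel_measurable (annealed \<nu>)"
  shows "(\<integral>\<^sup>+z. f z \<partial>annealed \<nu>) =
    (\<integral>\<^sup>+w. \<integral>\<^sup>+U. f (w, U) \<partial>PiM UNIV (\<lambda>_. unif) \<partial>PiM UNIV (\<lambda>_. \<nu>))"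
proof -
  interpret U: prob_space "PiM UNIV (\<lambda>_::nat. unif)"
    by (intro prob_space_PiM prob_space_unif)
  show ?thesis
    using assms(2) unfolding annealed_def by (subst U.nn_integral_fst[symmetric]) simp_all
qed

lemma prob_space_annealed: "prob_space \<nu> \<Longrightarrow> prob_space (annealed \<nu>)"
  unfolding annealed_def
  by (intro prob_space_pair prob_space_PiM prob_space_unif)

lemma measurable_gain_annealed:
  assumes "sets \<nu> = sets borel"
  shows "(\<lambda>z. gain (fst z) n F N l x (snd z)) \<in> borel_measurable (annealed \<nu>)"
  unfolding annealed_def
  by (rule measurable_gain)
     (auto intro!: measurable_compose[OF measurable_fst borel_measurable_component_PiM[OF assms]]
        measurable_compose[OF measurable_snd borel_measurable_component_PiM])

lemma AE_env_in_unit: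
  assumes "prob_space \<nu>" "AE a in \<nu>. 0 < a \<and> a < (1::real)"
  shows "AE w in PiM UNIV (\<lambda>_::int. \<nu>). \<forall>x. 0 < w x \<and> w x < 1"
  unfolding AE_all_countable by (intro allI AE_PiM_component) (use assms in auto)

lemma nn_integral_gain_annealed_le:
  assumes "prob_space \<nu>" and sets: "sets \<nu> = sets borel" and AE: "AE a in \<nu>. 0 < a \<and> a < 1" and "t \<noteq> 0"
  shows "(\<integral>\<^sup>+z. (SUP N. gain (fst z) (int n) (\<lambda>l. \<Prod>y<n. ennreal (exp (t * centred \<nu> \<alpha> \<beta> (l (int (Suc y))) (l (int y)))))
      N (\<lambda>_. 0) 0 (snd z)) \<partial>annealed \<nu>) \<le>
    ennreal (exp (t\<^sup>2 * (1 / real ((\<alpha> + \<beta>) choose \<alpha>))\<^sup>2 / 8)) ^ n"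
proof -
  let ?\<phi> = "\<lambda>i j. ennreal (exp (t * centred \<nu> \<alpha> \<beta> i j))"
  let ?F = "\<lambda>l. \<Prod>y<n. ?\<phi> (l (int (Suc y))) (l (int y))"
  note [measurable] = measurable_gain_annealed[OF sets]
  have "(\<integral>\<^sup>+z. (SUP N. gain (fst z) (int n) ?F N (\<lambda>_. 0) 0 (snd z)) \<partial>annealed \<nu>) =
    (\<integral>\<^sup>+w. \<integral>\<^sup>+U. (SUP N. gain w (int n) ?F N (\<lambda>_. 0) 0 U) \<partial>PiM UNIV (\<lambda>_. unif) \<partial>PiM UNIV (\<lambda>_. \<nu>))"
    by (subst nn_integral_annealed[OF assms(1)]) (simp_all del: prod_ennreal)
  also have "\<dots> \<le> (\<integral>\<^sup>+w. chain ?\<phi> w n 0 (\<lambda>_. 0) 0 \<partial>PiM UNIV (\<lambda>_::int. \<nu>))"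
  proof (rule nn_integral_mono_AE)
    show "AE w in PiM UNIV (\<lambda>_. \<nu>). (\<integral>\<^sup>+U. (SUP N. gain w (int n) ?F N (\<lambda>_. 0) 0 U) \<partial>PiM UNIV (\<lambda>_. unif))
        \<le> chain ?\<phi> w n 0 (\<lambda>_. 0) 0"
      using AE_env_in_unit[OF assms(1) AE]
    proof eventually_elim
      case (elim w)
      have "0 \<le> w x \<and> w x \<le> 1" for x using elim by (simp add: less_imp_le)
      then show ?case
        unfolding nn_integral_SUP_gain by (intro SUP_least nn_integral_gain_le_chain) auto
    qed
  qed
  also have "\<dots> \<le> ennreal (exp (t\<^sup>2 * (1 / real ((\<alpha> + \<beta>) choose \<alpha>))\<^sup>2 / 8)) ^ n"
    by (intro nn_integral_chain_le exp_centred_le assms)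
  finally show ?thesis .
qed

text \<open>With \<open>r = 1 / rho\<close> the drift hypothesis is that of
  \<open>perpetuity_infinite\<close>, so the series attached to the sites left of \<open>n\<close>
  diverges and escape has probability 0.\<close>

lemma walk_hits_AE:
  assumes "prob_space \<nu>" and sets: "sets \<nu> = sets borel" and AE: "AE a in \<nu>. 0 < a \<and> a < 1"
    and fin: "(\<integral>\<^sup>+ a. ennreal (max 0 (ln (rho a))) \<partial>\<nu>) < \<infinity>"
    and le: "(\<integral>\<^sup>+ a. ennreal (max 0 (ln (rho a))) \<partial>\<nu>) \<le> (\<integral>\<^sup>+ a. ennreal (max 0 (- ln (rho a))) \<partial>\<nu>)"
  shows "AE z in annealed \<nu>. (SUP N. gain (fst z) (int n) (\<lambda>_. 1) N (\<lambda>_. 0) 0 (snd z)) = 1"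
proof -
  interpret A: prob_space "annealed \<nu>" by (intro prob_space_annealed assms)
  interpret E: prob_space "PiM UNIV (\<lambda>_::int. \<nu>)" by (intro prob_space_PiM assms)
  note [measurable] = measurable_gain_annealed[OF sets]
  define r :: "real \<Rightarrow> real" where "r a = a / (1 - a)" for a
  have rho: "AE a in \<nu>. ln (rho a) = - ln (r a)"
    using AE by eventually_elim (simp add: rho_def r_def ln_div)
  have max0: "ennreal (max 0 x) = ennreal x" for x
    by (auto simp: max_def ennreal_neg)
  have i1: "(\<integral>\<^sup>+ a. ennreal (max 0 (ln (rho a))) \<partial>\<nu>) = (\<integral>\<^sup>+ a. ennreal (- ln (r a)) \<partial>\<nu>)"
    using rho by (intro nn_integral_cong_AE) (auto simp: max0 elim: eventually_mono)
  have i2: "(\<integral>\<^sup>+ a. ennreal (max 0 (- ln (rho a))) \<partial>\<nu>) = (\<integral>\<^sup>+ a. ennreal (ln (r a)) \<partial>\<nu>)"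
    using rho by (intro nn_integral_cong_AE) (auto simp: max0 elim: eventually_mono)
  have inf: "AE s in PiM UNIV (\<lambda>_::nat. \<nu>). (\<Sum>k. \<Prod>j<k. ennreal (r (s j))) = \<infinity>"
  proof (rule perpetuity_infinite)
    show "r \<in> borel_measurable \<nu>"
      unfolding r_def by (subst measurable_cong_sets[OF sets refl]) measurable
    show "AE a in \<nu>. 0 < r a"
      using AE by eventually_elim (simp add: r_def)
  qed (use assms(1) fin le in \<open>simp_all only: i1 i2\<close>)
  \<comment> \<open>The sites \<open>n - 1\<close>, \<open>n - 2\<close>, and so on, read leftwards,
    form an i.i.d. sequence because the reindexing is injective.\<close>
  have D: "PiM UNIV (\<lambda>_::nat. \<nu>) =
      distr (PiM UNIV (\<lambda>_::int. \<nu>)) (PiM UNIV (\<lambda>_::nat. \<nu>)) (\<lambda>w j. w (int n - 1 - int j))"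
    using distr_PiM_reindex[of UNIV "\<lambda>_. \<nu>" "\<lambda>j. int n - 1 - int j" "UNIV :: nat set"] assms(1)
    by (simp add: inj_on_def restrict_def)
  have "AE s in distr (PiM UNIV (\<lambda>_::int. \<nu>)) (PiM UNIV (\<lambda>_::nat. \<nu>)) (\<lambda>w j. w (int n - 1 - int j)).
      (\<Sum>k. \<Prod>j<k. ennreal (r (s j))) = \<infinity>"
    by (subst D[symmetric]) (rule inf)
  moreover have "(\<lambda>w j. w (int n - 1 - int j)) \<in> PiM UNIV (\<lambda>_::int. \<nu>) \<rightarrow>\<^sub>M PiM UNIV (\<lambda>_::nat. \<nu>)"
    by (rule measurable_PiM_single') (auto simp: space_PiM PiE_def)
  ultimately have W: "AE w in PiM UNIV (\<lambda>_::int. \<nu>). (\<Sum>k. \<Prod>j<k. ennreal (r (w (int n - 1 - int j)))) = \<infinity>"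
    by (rule AE_distrD[rotated])
  let ?H = "\<lambda>z. SUP N. gain (fst z) (int n) (\<lambda>_. 1) N (\<lambda>_. 0) 0 (snd z)"
  have "(\<integral>\<^sup>+z. ?H z \<partial>annealed \<nu>) =
    (\<integral>\<^sup>+w. \<integral>\<^sup>+U. (SUP N. gain w (int n) (\<lambda>_. 1) N (\<lambda>_. 0) 0 U) \<partial>PiM UNIV (\<lambda>_. unif) \<partial>PiM UNIV (\<lambda>_. \<nu>))"
    by (subst nn_integral_annealed[OF assms(1)]) simp_all
  also have "\<dots> = (\<integral>\<^sup>+w. 1 \<partial>PiM UNIV (\<lambda>_::int. \<nu>))"
  proof (rule nn_integral_cong_AE)
    show "AE w in PiM UNIV (\<lambda>_. \<nu>). (\<integral>\<^sup>+U. (SUP N. gain w (int n) (\<lambda>_. 1) N (\<lambda>_. 0) 0 U) \<partial>PiM UNIV (\<lambda>_. unif)) = 1"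
      using AE_env_in_unit[OF assms(1) AE] W
    proof eventually_elim
      case (elim w)
      then have "(\<Sum>k. ennreal (\<Prod>j<k. r (w (int n - 1 - int j)))) = \<infinity>"
        by (simp add: prod_ennreal r_def less_imp_le)
      then show ?case
        using elim by (intro nn_integral_SUP_gain_one) (auto simp: r_def)
    qed
  qed
  finally have 1: "(\<integral>\<^sup>+z. ?H z \<partial>annealed \<nu>) = 1" by (simp add: E.emeasure_space_1)
  have le1: "?H z \<le> 1" for z by (intro SUP_least gain_one_le)
  \<comment> \<open>A function bounded by 1 with integral 1 over a probability space equals 1 almost
    everywhere.\<close>
  have "(\<integral>\<^sup>+z. 1 - ?H z \<partial>annealed \<nu>) = 0"
    by (subst nn_integral_diff) (use 1 le1 in \<open>auto simp: A.emeasure_space_1\<close>)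
  then have "AE z in annealed \<nu>. 1 - ?H z = 0"
    by (subst (asm) nn_integral_0_iff_AE) auto
  then show ?thesis
  proof eventually_elim
    case (elim z)
    then show ?case using le1[of z] by (metis antisym diff_eq_0_iff_ennreal)
  qed
qed

text \<open>Chernoff's bound, with \<sigma> selecting the tail. For
  \<open>x = sqrt (z / (2 n))\<close>, the choice \<open>t = 4 x / c\<close> minimises
  \<open>- t n c x + t^2 c^2 n / 8\<close>; the two terms become \<open>- 2 z\<close> and
  \<open>z\<close>.\<close>

lemma deviation_bound:
  fixes \<alpha> \<beta> n :: nat
  assumes "prob_space \<nu>" and sets: "sets \<nu> = sets borel" and AE: "AE a in \<nu>. 0 < a \<and> a < 1"
    and "n \<ge> 1" and "z > 0" and "\<sigma> = 1 \<or> \<sigma> = (-1::real)"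
  defines "c \<equiv> 1 / real ((\<alpha> + \<beta>) choose \<alpha>)"
  defines "t \<equiv> 4 * sqrt (z / (2 * real n)) / c"
  shows "emeasure (annealed \<nu>) {v \<in> space (annealed \<nu>).
      ennreal (exp (t * (real n * c * sqrt (z / (2 * real n))))) \<le>
      (SUP N. gain (fst v) (int n) (\<lambda>l. \<Prod>y<n. ennreal (exp (\<sigma> * t * centred \<nu> \<alpha> \<beta> (l (int (Suc y))) (l (int y)))))
        N (\<lambda>_. 0) 0 (snd v))} \<le> ennreal (exp (- z))"
proof -
  let ?G = "\<lambda>v. SUP N. gain (fst v) (int n) (\<lambda>l. \<Prod>y<n. ennreal (exp (\<sigma> * t * centred \<nu> \<alpha> \<beta> (l (int (Suc y))) (l (int y)))))
        N (\<lambda>_. 0) 0 (snd v)"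
  note [measurable] = measurable_gain_annealed[OF sets]
  define x where "x = sqrt (z / (2 * real n))"
  have c: "c > 0" by (simp add: c_def)
  have x: "x > 0" "x\<^sup>2 = z / (2 * real n)" using assms(4,5) by (simp_all add: x_def)
  have t: "t = 4 * x / c" by (simp add: t_def x_def)
  let ?a = "t * (real n * c * x)"
  have a: "?a = 2 * z" using c x(2) assms(4) by (simp add: t field_simps power2_eq_square)
  have t0: "\<sigma> * t \<noteq> 0" using x c assms(6) by (auto simp: t)
  have s2: "(\<sigma> * t)\<^sup>2 * c\<^sup>2 / 8 * real n = z"
    using c x(2) assms(4,6) by (auto simp: t field_simps power2_eq_square)
  \<comment> \<open>Rescaling by \<open>exp (- ?a)\<close> brings the event into the form required
    by Markov's inequality.\<close>
  have "emeasure (annealed \<nu>) {v \<in> space (annealed \<nu>). ennreal (exp ?a) \<le> ?G v} =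
    emeasure (annealed \<nu>) ({v \<in> space (annealed \<nu>). 1 \<le> ennreal (exp (- ?a)) * ?G v})"
  proof (intro arg_cong[where f = "emeasure (annealed \<nu>)"] Collect_cong conj_cong refl)
    fix v
    have "(1 \<le> ennreal (exp (- ?a)) * ?G v) = (ennreal (exp ?a) * 1 \<le> ennreal (exp ?a) * (ennreal (exp (- ?a)) * ?G v))"
      by (subst ennreal_mult_le_mult_iff) auto
    also have "ennreal (exp ?a) * (ennreal (exp (- ?a)) * ?G v) = ?G v"
      by (simp add: mult.assoc[symmetric] ennreal_mult[symmetric] exp_minus del: prod_ennreal)
    finally show "(ennreal (exp ?a) \<le> ?G v) = (1 \<le> ennreal (exp (- ?a)) * ?G v)" by simp
  qed
  also have "\<dots> \<le> ennreal (exp (- ?a)) * (\<integral>\<^sup>+v. ?G v * indicator (space (annealed \<nu>)) v \<partial>annealed \<nu>)"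
    by (rule nn_integral_Markov_inequality) (simp_all del: prod_ennreal)
  also have "(\<integral>\<^sup>+v. ?G v * indicator (space (annealed \<nu>)) v \<partial>annealed \<nu>) = (\<integral>\<^sup>+v. ?G v \<partial>annealed \<nu>)"
    by (intro nn_integral_cong) simp
  also have "ennreal (exp (- ?a)) * \<dots> \<le> ennreal (exp (- ?a)) * ennreal (exp ((\<sigma> * t)\<^sup>2 * c\<^sup>2 / 8)) ^ n"
    unfolding c_def using nn_integral_gain_annealed_le[OF assms(1-3) t0]
    by (intro mult_left_mono) (auto simp: c_def)
  also have "\<dots> = ennreal (exp (- ?a + (\<sigma> * t)\<^sup>2 * c\<^sup>2 / 8 * real n))"
    by (simp only: ennreal_power exp_ge_zero exp_of_nat2_mult[symmetric] exp_add ennreal_mult)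
  also have "\<dots> = ennreal (exp (- z))" unfolding s2 a by simp
  finally show ?thesis unfolding x_def .
qed

theorem theorem3p2:
  fixes \<nu> :: "real measure" and \<alpha> \<beta> n :: nat and z :: real
  assumes "prob_space \<nu>" and "sets \<nu> = sets borel"
    and "AE a in \<nu>. 0 < a \<and> a < 1"
    and "(\<integral>\<^sup>+ a. ennreal (max 0 (ln (rho a))) \<partial>\<nu>) < \<infinity>"
    and "(\<integral>\<^sup>+ a. ennreal (max 0 (ln (rho a))) \<partial>\<nu>) \<le> (\<integral>\<^sup>+ a. ennreal (max 0 (- ln (rho a))) \<partial>\<nu>)"
    and "n \<ge> 1" and "z > 0"
  shows "measure (annealed \<nu>)
     {(\<omega>, U). (\<nexists>t. walk \<omega> U t = int n) \<or>
        (Nn \<alpha> \<omega> U n > 0 \<and>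
         \<bar>mhat \<alpha> \<beta> \<omega> U n - mom \<nu> \<alpha> \<beta>\<bar> \<ge>
           real n / real (Nn \<alpha> \<omega> U n) / real ((\<alpha> + \<beta>) choose \<alpha>) * sqrt (z / (2 * real n)))}
   \<le> 2 * exp (- z)"
proof -
  let ?A = "annealed \<nu>"
  interpret A: prob_space ?A by (intro prob_space_annealed assms)
  note [measurable] = measurable_gain_annealed[OF assms(2)]
  define E where "E = {(w, U). (\<nexists>t. walk w U t = int n) \<or>
        (Nn \<alpha> w U n > 0 \<and>
         \<bar>mhat \<alpha> \<beta> w U n - mom \<nu> \<alpha> \<beta>\<bar> \<ge>
           real n / real (Nn \<alpha> w U n) / real ((\<alpha> + \<beta>) choose \<alpha>) * sqrt (z / (2 * real n)))}"
  define c where "c = 1 / real ((\<alpha> + \<beta>) choose \<alpha>)"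
  define x where "x = sqrt (z / (2 * real n))"
  define t where "t = 4 * x / c"
  have pos: "c > 0" "x > 0" "t > 0" using assms(6,7) by (simp_all add: c_def x_def t_def)
  define H where "H v = (SUP N. gain (fst v) (int n) (\<lambda>_. 1) N (\<lambda>_. 0) 0 (snd v))" for v
  define G where "G \<sigma> v = (SUP N. gain (fst v) (int n)
      (\<lambda>l. \<Prod>y<n. ennreal (exp (\<sigma> * t * centred \<nu> \<alpha> \<beta> (l (int (Suc y))) (l (int y))))) N (\<lambda>_. 0) 0 (snd v))" for \<sigma> v
  have [measurable]: "H \<in> borel_measurable ?A" "G \<sigma> \<in> borel_measurable ?A" for \<sigma>
    unfolding H_def G_def by measurable
  define B where "B \<sigma> = {v \<in> space ?A. ennreal (exp (t * (real n * c * x))) \<le> G \<sigma> v}" for \<sigma>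
  \<comment> \<open>Up to a null set the walk hits \<open>n\<close>; where it never does,
    \<open>H\<close> is 0.\<close>
  define B0 where "B0 = {v \<in> space ?A. H v \<noteq> 1}"
  have [measurable]: "B \<sigma> \<in> sets ?A" "B0 \<in> sets ?A" for \<sigma>
    unfolding B_def B0_def by measurable
  have B: "emeasure ?A (B \<sigma>) \<le> ennreal (exp (- z))" if "\<sigma> = 1 \<or> \<sigma> = -1" for \<sigma>
    unfolding B_def G_def t_def x_def c_def by (rule deviation_bound[OF assms(1-3,6,7) that])
  have B0: "emeasure ?A B0 = 0"
    using walk_hits_AE[OF assms(1-5), of n] unfolding B0_def H_def[symmetric]
    by (subst (asm) AE_iff_measurable[OF _ refl]) auto
  have sub: "E \<inter> space ?A \<subseteq> B0 \<union> (B 1 \<union> B (-1))"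
  proof
    fix v assume v: "v \<in> E \<inter> space ?A"
    obtain w U where vwU: "v = (w, U)" by (cases v)
    show "v \<in> B0 \<union> (B 1 \<union> B (-1))"
    proof (cases "\<exists>s. walk w U s = int n")
      case False
      then have "H v = 0" unfolding H_def vwU by (simp add: SUP_gain_walk)
      with v show ?thesis by (simp add: B0_def)
    next
      case True
      define S where "S = (\<Sum>y<n. centred \<nu> \<alpha> \<beta> (loc w U (hit w U n) (int (Suc y))) (loc w U (hit w U n) (int y)))"
      have G: "G \<sigma> v = ennreal (exp (\<sigma> * t * S))" for \<sigma>
        unfolding G_def vwU fst_conv snd_conv SUP_gain_walk
        using True by (simp add: prod_ennreal exp_sum[symmetric] S_def sum_distrib_left)
      define N where "N = real (Nn \<alpha> w U n)"
      have N: "N > 0" and dev: "\<bar>mhat \<alpha> \<beta> w U n - mom \<nu> \<alpha> \<beta>\<bar> \<ge> real n / N * c * x"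
        using v True by (auto simp: E_def vwU N_def c_def x_def)
      \<comment> \<open>The random factor \<open>1 / N\<close> occurs in both the deviation and the
        threshold, so it cancels and the bound on \<open>S\<close> is deterministic.\<close>
      have "mhat \<alpha> \<beta> w U n - mom \<nu> \<alpha> \<beta> = S / N"
        unfolding S_def sum_centred_Zn mhat_def using N by (simp add: N_def diff_divide_distrib)
      with dev N have "\<bar>S\<bar> \<ge> real n * c * x"
        by (simp add: field_simps)
      then have "real n * c * x \<le> 1 * S \<or> real n * c * x \<le> (-1) * S" by linarith
      then show ?thesis
      proof
        assume "real n * c * x \<le> 1 * S"
        then have "t * (real n * c * x) \<le> t * (1 * S)" using pos by (intro mult_left_mono) auto
        then have "v \<in> B 1" using v by (simp add: B_def G)
        then show ?thesis by simp
      next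
        assume "real n * c * x \<le> (-1) * S"
        then have "t * (real n * c * x) \<le> t * ((-1) * S)" using pos by (intro mult_left_mono) auto
        then have "v \<in> B (-1)" using v by (simp add: B_def G)
        then show ?thesis by simp
      qed
    qed
  qed
  \<comment> \<open>\<open>measure\<close> is 0 on a non-measurable set, so only the measurable case
    calls for the union bound.\<close>
  have "measure ?A E \<le> 2 * exp (- z)"
  proof (cases "E \<in> sets ?A")
    case True
    have "emeasure ?A E \<le> emeasure ?A (B0 \<union> (B 1 \<union> B (-1)))"
      using sub sets.sets_into_space[OF True] by (intro emeasure_mono) (auto simp: Int_absorb2)
    also have "\<dots> \<le> emeasure ?A B0 + (emeasure ?A (B 1) + emeasure ?A (B (-1)))"
      by (intro order_trans[OF emeasure_subadditive] add_left_mono) (auto intro: emeasure_subadditive)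
    also have "\<dots> \<le> 0 + (ennreal (exp (- z)) + ennreal (exp (- z)))"
      by (intro add_mono B) (simp_all add: B0)
    also have "\<dots> = ennreal (2 * exp (- z))"
      by (simp add: ennreal_plus[symmetric] del: ennreal_plus)
    finally show ?thesis
      by (simp add: A.emeasure_eq_measure)
  qed (simp add: measure_notin_sets)
  then show ?thesis by (simp only: E_def)
qed

end
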